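(* Let $c\in(0,1)$ and let $(G_n)_{n\in\mathbb{Z}}$ be i.i.d. $\mathrm{Geom}(c)$ random variables. Then the random set $\mathbb{Z}\cap\bigcup_{n\in\mathbb{Z}}(n-G_n,\,n+G_n)$ is stochastically dominated by the open set of i.i.d. site percolation on $\mathbb{Z}$ with parameter $\min(4\sqrt{c},1)$.
   Context: For $c\in(0,1)$, a random variable $X$ has distribution $\mathrm{Geom}(c)$ if $\mathbb{P}(X=r)=(1-c)c^r$ for $r=0,1,2,\dots$. The open interval $(a,b)$ is taken to be empty if $a=b$. The open set of i.i.d. site percolation on $\mathbb{Z}$ with parameter $p$ is the random subset of $\mathbb{Z}$ containing each integer with probability $p$, independently for different integers. For random variables $X,Y$ taking values in the same partially ordered space, $X$ stochastically dominates $Y$ (equivalently, $Y$ is stochastically dominated by $X$) if there exist $X',Y'$ on some probability space with $X'$ equal in law to $X$, $Y'$ equal in law to $Y$, and $X'\geq Y'$ almost surely. For random sets the partial order is inclusion. *)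

theory Defs
  imports "HOL-Probability.Probability"
begin

definition has_Geom :: "'w measure \<Rightarrow> ('w \<Rightarrow> nat) \<Rightarrow> real \<Rightarrow> bool" where
  "has_Geom M X c \<longleftrightarrow>
     X \<in> measurable M (count_space UNIV) \<and>
     (\<forall>r. measure M {w \<in> space M. X w = r} = (1 - c) * c ^ r)"

text \<open>Random subsets of a type carry the product \<open>\<sigma>\<close>-algebra, i.e.\ the one generated by
  the events that a given point belongs to the set.\<close>

definition subset_space :: "'a set measure" where
  "subset_space = sigma UNIV (range (\<lambda>x. {A. x \<in> A}))"

definition iid_site_percolation :: "'w measure \<Rightarrow> ('w \<Rightarrow> int set) \<Rightarrow> real \<Rightarrow> bool" where
  "iid_site_percolation M W p \<longleftrightarrow>
     prob_space.indep_vars M (\<lambda>_. count_space UNIV) (\<lambda>n w. n \<in> W w) UNIV \<and>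
     (\<forall>n. measure M {w \<in> space M. n \<in> W w} = p)"

text \<open>HOL cannot quantify over the type of the coupling space inside a definition, so that type is
  fixed to pairs of values. This loses no generality: see \<open>stochastically_dominatesI\<close>.\<close>

definition stochastically_dominates ::
  "'s::order measure \<Rightarrow> 'w measure \<Rightarrow> ('w \<Rightarrow> 's) \<Rightarrow> 'v measure \<Rightarrow> ('v \<Rightarrow> 's) \<Rightarrow> bool" where
  "stochastically_dominates S M X N Y \<longleftrightarrow>
     X \<in> measurable M S \<and> Y \<in> measurable N S \<and>
     (\<exists>(\<Omega> :: ('s \<times> 's) measure) X' Y'.
        prob_space \<Omega> \<and> X' \<in> measurable \<Omega> S \<and> Y' \<in> measurable \<Omega> S \<and>
        distr \<Omega> S X' = distr M S X \<and> distr \<Omega> S Y' = distr N S Y \<and>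
        (AE w in \<Omega>. X' w \<ge> Y' w))"

lemma stochastically_dominatesI:
  fixes \<Omega> :: "'u measure" and S :: "'s::order measure"
  assumes X: "X \<in> measurable M S" and Y: "Y \<in> measurable N S"
    and "prob_space \<Omega>"
    and X': "X' \<in> measurable \<Omega> S" and Y': "Y' \<in> measurable \<Omega> S"
    and dX: "distr \<Omega> S X' = distr M S X" and dY: "distr \<Omega> S Y' = distr N S Y"
    and AE: "AE w in \<Omega>. X' w \<ge> Y' w"
  shows "stochastically_dominates S M X N Y"
proof -
  define C where "C = space S \<times> space S"
  define Z where "Z = (\<lambda>w. (X' w, Y' w))"
  define K where "K = completion \<Omega>"
  define F where "F = {B. B \<subseteq> C \<and> Z -` B \<inter> space K \<in> sets K}"
  define D where "D = sigma C F"
  interpret O: prob_space \<Omega> by fact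
  have K: "prob_space K"
    unfolding K_def by (intro prob_spaceI) (simp add: O.emeasure_space_1)
  have spK: "space K = space \<Omega>" by (simp add: K_def)
  have XK: "X' \<in> measurable K S" and YK: "Y' \<in> measurable K S"
    unfolding K_def by (rule measurable_completion, fact)+
  have FC: "F \<subseteq> Pow C" by (auto simp: F_def)
  have spD: "space D = C" using FC by (simp add: D_def)
  have FD: "B \<in> sets D" if "B \<in> F" for B using FC that by (auto simp: D_def)
  have ZC: "Z w \<in> C" if "w \<in> space K" for w
    using that measurable_space[OF XK] measurable_space[OF YK] by (auto simp: Z_def C_def)
  have Z: "Z \<in> measurable K D"
    unfolding D_def by (rule measurable_measure_of[OF FC]) (auto simp: ZC F_def)
  have mf: "fst \<in> measurable D S"
  proof (rule measurableI)
    fix A assume A: "A \<in> sets S"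
    have "Z -` (fst -` A \<inter> C) \<inter> space K = X' -` A \<inter> space K"
      using ZC by (auto simp: Z_def)
    then show "fst -` A \<inter> space D \<in> sets D"
      using measurable_sets[OF XK A] by (auto intro!: FD simp: spD F_def)
  qed (auto simp: spD C_def)
  have ms: "snd \<in> measurable D S"
  proof (rule measurableI)
    fix A assume A: "A \<in> sets S"
    have "Z -` (snd -` A \<inter> C) \<inter> space K = Y' -` A \<inter> space K"
      using ZC by (auto simp: Z_def)
    then show "snd -` A \<inter> space D \<in> sets D"
      using measurable_sets[OF YK A] by (auto intro!: FD simp: spD F_def)
  qed (auto simp: spD C_def)
  have AEK: "AE w in K. Y' w \<le> X' w"
    unfolding K_def using AE by (rule AE_completion)
  have set: "{w \<in> space K. \<not> Y' w \<le> X' w} \<in> sets K"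
  proof -
    obtain A where A: "A \<in> null_sets \<Omega>" "{w \<in> space \<Omega>. \<not> Y' w \<le> X' w} \<subseteq> A"
      using AE by (auto simp: eventually_ae_filter)
    have "{w \<in> space \<Omega>. \<not> Y' w \<le> X' w} \<in> null_sets (completion \<Omega>)"
      using A by (metis null_sets_completion_subset null_sets_completionI)
    then show ?thesis by (auto simp: K_def)
  qed
  define G where "G = {q \<in> C. snd q \<le> fst q}"
  have GF: "G \<in> F"
  proof -
    have "Z -` G \<inter> space K = space K - {w \<in> space K. \<not> Y' w \<le> X' w}"
      using ZC by (auto simp: Z_def G_def)
    also have "\<dots> \<in> sets K" using set by auto
    finally show ?thesis by (auto simp: F_def G_def)
  qed
  have AED: "AE q in distr K D Z. snd q \<le> fst q"
  proof (subst AE_distr_iff[OF Z])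
    show "{q \<in> space D. snd q \<le> fst q} \<in> sets D"
      using FD[OF GF] by (simp add: G_def spD)
    show "AE w in K. snd (Z w) \<le> fst (Z w)" using AEK by (simp add: Z_def)
  qed
  have e: "distr K S f = distr \<Omega> S f" if "f \<in> measurable \<Omega> S" for f
  proof (rule measure_eqI)
    fix A assume "A \<in> sets (distr K S f)"
    then have A: "A \<in> sets S" by simp
    have fK: "f \<in> measurable K S" unfolding K_def using that by (rule measurable_completion)
    show "emeasure (distr K S f) A = emeasure (distr \<Omega> S f) A"
      using measurable_sets[OF that A]
      by (simp add: emeasure_distr[OF fK A] emeasure_distr[OF that A] spK)
        (simp add: K_def)
  qed simp
  have d1: "distr (distr K D Z) S fst = distr M S X"
    using distr_distr[OF mf Z] e[OF X'] dX by (simp add: comp_def Z_def)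
  have d2: "distr (distr K D Z) S snd = distr N S Y"
    using distr_distr[OF ms Z] e[OF Y'] dY by (simp add: comp_def Z_def)
  have "prob_space (distr K D Z)" using K Z by (rule prob_space.prob_space_distr)
  moreover have "fst \<in> measurable (distr K D Z) S" "snd \<in> measurable (distr K D Z) S"
    using mf ms by simp_all
  ultimately show ?thesis
    unfolding stochastically_dominates_def using X Y d1 d2 AED by blast
qed

end

theory Submission
  imports Defs
begin

text \<open>Write \<open>t = sqrt c\<close>; only \<open>t \<le> 1/4\<close> matters. A random set \<open>X\<close> is dominated by percolation of parameter
\<open>p\<close> as soon as the points of the space can be revealed one after another so that, given everything seen
before, the next point lies in \<open>X\<close> with conditional probability at most \<open>p\<close>: one then adds to \<open>X\<close>, at
each step, an independent point with exactly the missing probability (\<open>percolation_coupling\<close>). If the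
integers are revealed in the order \<open>0, 1, -1, 2, -2, \<dots>\<close>, the points seen before always form an interval
and the next point is adjacent to it.

The union of the intervals \<open>(n - G n, n + G n)\<close> does not have this property with \<open>p\<close> of order \<open>t\<close>. These
intervals contain an odd number of integers, so two points covered right after an uncovered one are, for
small \<open>c\<close>, as likely to come from an interval of three points as from two single points, so that the
conditional probability for the third point to be covered is close to \<open>1/2\<close>. The remedy is to enlarge the set by intervals
centred at half-integers. Take independent variables \<open>\<Gamma> n\<close> with law \<open>Geom(t)\<close>, where \<open>n\<close> stands for the
centre \<open>n/2\<close>, and let \<open>k\<close> be covered if \<open>\<bar>2 k - n\<bar> + 2 \<le> \<Gamma> n\<close> for some \<open>n\<close>. Since \<open>\<Gamma> (2 n) div 2\<close> has law
\<open>Geom(c)\<close>, the even indices alone reproduce the original set, so that it suffices to treat the larger one.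

For the larger set, the intervals on either side of an uncovered point do not interact: given that \<open>z\<close>
is uncovered, what happens to the left of \<open>z\<close> is independent of what happens to the right
(\<open>uncovered_indep\<close>). Hence the uncovered points form a stationary renewal process. Let \<open>u j\<close> be the
probability that \<open>z + j\<close> is uncovered given that \<open>z\<close> is, \<open>v = lim u\<close> the density of uncovered points, and
\<open>T m\<close> the probability that \<open>z + 1, \<dots>, z + m\<close> are all covered given that \<open>z\<close> is uncovered. Splitting
according to the last uncovered point gives
\<open>\<Sum>j\<le>m. u j * T (m - j) = 1\<close>, and the probability that \<open>m\<close> consecutive points are covered is
\<open>1 - v * (\<Sum>i<m. T i)\<close>. By the independence at the last uncovered point of the window, the conditional
probabilities to be bounded are the ratios of consecutive terms of these two sequences.

Here \<open>u\<close> is an explicit finite product with \<open>u (j + 1) = u j * (1 - t^(j + 2)) * (1 - t^(j + 3))\<close>. Thanks to the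
half-integer centres its increments \<open>\<delta> j = u j - u (j + 1)\<close> satisfy \<open>\<delta> (j + 1) \<le> t * \<delta> j\<close>. Subtracting two
consecutive renewal equations gives \<open>T (m + 1) = (\<Sum>j\<le>m. \<delta> j * T (m - j))\<close>, and comparison with the same
formula for \<open>T m\<close> yields \<open>T (m + 1) \<le> (\<delta> 0 + t) * T m\<close>. The same argument applied to the excess \<open>u j - v\<close>
treats the second sequence, with ratio \<open>\<delta> 0 + 2 * t\<close>. As \<open>\<delta> 0 \<le> 2 * t\<close>, both ratios are at most \<open>4 * t\<close>
(\<open>prob_extend_right\<close>).\<close>

section \<open>Random sets are determined by their patterns on finite windows\<close>

lemma space_subset_space [simp]: "space subset_space = UNIV"
  by (simp add: subset_space_def)

lemma measurable_subset_space_iff: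
  fixes X :: "'w \<Rightarrow> 'a set"
  shows "X \<in> measurable M subset_space \<longleftrightarrow> (\<forall>x. {w \<in> space M. x \<in> X w} \<in> sets M)"
proof
  assume X: "X \<in> measurable M subset_space"
  show "\<forall>x. {w \<in> space M. x \<in> X w} \<in> sets M"
  proof
    fix x :: 'a
    have "{A. x \<in> A} \<in> sets subset_space"
      by (auto simp: subset_space_def)
    from measurable_sets[OF X this] show "{w \<in> space M. x \<in> X w} \<in> sets M"
      by (simp add: vimage_def Int_def conj_commute)
  qed
next
  assume "\<forall>x. {w \<in> space M. x \<in> X w} \<in> sets M"
  then show "X \<in> measurable M subset_space"
    unfolding subset_space_def
    by (intro measurable_measure_of) (auto simp: vimage_def Int_def conj_commute)
qed

lemma sets_member_event:
  "X \<in> measurable M subset_space \<Longrightarrow> {w \<in> space M. x \<in> X w} \<in> sets M"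
  by (simp add: measurable_subset_space_iff)

lemma sets_pattern_event:
  assumes "X \<in> measurable M subset_space" "finite I"
  shows "{w \<in> space M. X w \<inter> I = A} \<in> sets M"
proof (cases "A \<subseteq> I")
  case True
  have [measurable]: "Measurable.pred M (\<lambda>w. x \<in> X w)" for x
    using sets_member_event[OF assms(1), of x] by (simp add: pred_def)
  have "{w \<in> space M. X w \<inter> I = A} = {w \<in> space M. \<forall>x\<in>I. x \<in> X w \<longleftrightarrow> x \<in> A}"
    using True by blast
  also have "\<dots> \<in> sets M"
    using assms(2) by measurable
  finally show ?thesis .
next
  case False
  then have "{w \<in> space M. X w \<inter> I = A} = {}" by auto
  then show ?thesis by (simp only: sets.empty_sets)
qed

lemma member_event_eq_Union_patterns:
  assumes "x \<in> I"
  shows "{z \<in> \<Omega>. x \<in> X z} = (\<Union>A\<in>{A \<in> Pow I. x \<in> A}. {z \<in> \<Omega>. X z \<inter> I = A})"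
proof (intro equalityI subsetI)
  fix z assume "z \<in> {z \<in> \<Omega>. x \<in> X z}"
  with assms show "z \<in> (\<Union>A\<in>{A \<in> Pow I. x \<in> A}. {z \<in> \<Omega>. X z \<inter> I = A})"
    by (intro UN_I[of "X z \<inter> I"]) simp_all
qed auto

text \<open>The events prescribing the trace of a set on an initial segment of an enumeration form a \<open>\<pi>\<close>-system: two
of them are either disjoint or nested.\<close>
lemma distr_subset_space_eqI:
  fixes e :: "nat \<Rightarrow> 'a"
  assumes M: "prob_space M" and N: "prob_space N"
    and X: "X \<in> measurable M subset_space" and Y: "Y \<in> measurable N subset_space"
    and e: "surj e"
    and eq: "\<And>n A. A \<subseteq> e ` {..<n} \<Longrightarrow>
      measure M {w \<in> space M. X w \<inter> e ` {..<n} = A} = measure N {w \<in> space N. Y w \<inter> e ` {..<n} = A}"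
  shows "distr M subset_space X = distr N subset_space Y"
proof -
  interpret M: prob_space M by fact
  interpret N: prob_space N by fact
  define cyl where "cyl = (\<lambda>n A. {C. C \<inter> e ` {..<n} = A})"
  define E where "E = insert {} (range (\<lambda>(n, A). cyl n A))"
  have cyl_sets: "cyl n A \<in> sets subset_space" for n A
    using sets_pattern_event[of "\<lambda>w. w" subset_space "e ` {..<n}" A]
    by (simp add: cyl_def)
  have cyl_Int: "cyl n A \<inter> cyl m B \<in> E" if "n \<le> m" for n m A B
  proof (cases "B \<inter> e ` {..<n} = A")
    case True
    have "cyl n A \<inter> cyl m B = cyl m B"
      using True that by (auto simp: cyl_def)
    then show ?thesis by (auto simp: E_def)
  next
    case False
    have "cyl n A \<inter> cyl m B = {}"
      using False that by (force simp: cyl_def)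
    then show ?thesis by (simp add: E_def)
  qed
  show ?thesis
  proof (rule measure_eqI_generator_eq)
    show "Int_stable E"
    proof (rule Int_stableI)
      fix a b assume "a \<in> E" "b \<in> E"
      then consider "a = {} \<or> b = {}" | n A m B where "a = cyl n A" "b = cyl m B"
        by (auto simp: E_def)
      then show "a \<inter> b \<in> E"
      proof cases
        case 1
        then show ?thesis by (auto simp: E_def)
      next
        case 2
        then show ?thesis
          using cyl_Int[of n m A B] cyl_Int[of m n B A] by (cases "n \<le> m") (auto simp: Int_commute)
      qed
    qed
    show "E \<subseteq> Pow UNIV" by simp
    have sets_E: "sets subset_space = sigma_sets UNIV E"
    proof
      have "{A. x \<in> A} \<in> sigma_sets UNIV E" for x
      proof -
        obtain k where k: "x = e k" using e by (metis surjD)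
        have "{A. x \<in> A} = (\<Union>A \<in> {A \<in> Pow (e ` {..<Suc k}). x \<in> A}. cyl (Suc k) A)"
          using member_event_eq_Union_patterns[of x "e ` {..<Suc k}" UNIV "\<lambda>A. A"]
          by (simp add: cyl_def k)
        also have "\<dots> \<in> sigma_sets UNIV E"
        proof (rule sigma_sets_UNION)
          show "countable (cyl (Suc k) ` {A \<in> Pow (e ` {..<Suc k}). x \<in> A})"
            by (intro countable_image countable_finite) auto
        qed (auto simp: E_def)
        finally show ?thesis .
      qed
      then show "sets subset_space \<subseteq> sigma_sets UNIV E"
        unfolding subset_space_def by (auto intro!: sigma_sets_mono)
      have "E \<subseteq> sets subset_space"
        using cyl_sets by (auto simp: E_def)
      then show "sigma_sets UNIV E \<subseteq> sets subset_space"
        using sets.sigma_sets_subset[of E subset_space] by simp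
    qed
    then show "sets (distr M subset_space X) = sigma_sets UNIV E"
      and "sets (distr N subset_space Y) = sigma_sets UNIV E" by simp_all
    have "UNIV = cyl 0 {}" by (auto simp: cyl_def)
    then show "range (\<lambda>_::nat. UNIV) \<subseteq> E" by (auto simp: E_def)
    show "(\<Union>i::nat. UNIV :: 'a set set) = UNIV" by simp
    show "emeasure (distr M subset_space X) UNIV \<noteq> \<infinity>" for i :: nat
      using M.emeasure_space_1 emeasure_distr[OF X, of UNIV] sets.top[of "subset_space :: 'a set measure"]
      by simp
    fix c assume "c \<in> E"
    then consider "c = {}" | n A where "c = cyl n A" by (auto simp: E_def)
    then show "emeasure (distr M subset_space X) c = emeasure (distr N subset_space Y) c"
    proof cases
      case 2
      have "emeasure (distr M subset_space X) c = measure M {w \<in> space M. X w \<inter> e ` {..<n} = A}"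
        unfolding 2 emeasure_distr[OF X cyl_sets] M.emeasure_eq_measure
        by (simp add: cyl_def vimage_def Int_def conj_commute)
      moreover have "emeasure (distr N subset_space Y) c = measure N {w \<in> space N. Y w \<inter> e ` {..<n} = A}"
        unfolding 2 emeasure_distr[OF Y cyl_sets] N.emeasure_eq_measure
        by (simp add: cyl_def vimage_def Int_def conj_commute)
      moreover have "measure M {w \<in> space M. X w \<inter> e ` {..<n} = A} = measure N {w \<in> space N. Y w \<inter> e ` {..<n} = A}"
      proof (cases "A \<subseteq> e ` {..<n}")
        case False
        then have "{w \<in> space M. X w \<inter> e ` {..<n} = A} = {}" "{w \<in> space N. Y w \<inter> e ` {..<n} = A} = {}"
          by auto
        then show ?thesis by (simp only: measure_empty)
      qed (rule eq)
      ultimately show ?thesis by simp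
    qed simp
  qed
qed

definition pattern_weight :: "real \<Rightarrow> (nat \<Rightarrow> 'a) \<Rightarrow> nat \<Rightarrow> 'a set \<Rightarrow> real" where
  "pattern_weight p e n B = (\<Prod>i<n. if e i \<in> B then p else 1 - p)"

lemma percolation_measurable:
  assumes "prob_space N" "iid_site_percolation N W p"
  shows "W \<in> measurable N subset_space"
proof -
  interpret prob_space N by fact
  have "(\<lambda>w. n \<in> W w) \<in> measurable N (count_space UNIV)" for n
    using assms(2) unfolding iid_site_percolation_def indep_vars_def by auto
  then show ?thesis
    by (simp add: measurable_subset_space_iff pred_def)
qed

lemma percolation_pattern:
  fixes e :: "nat \<Rightarrow> int"
  assumes "prob_space N" "iid_site_percolation N W p" and e: "inj e" and B: "B \<subseteq> e ` {..<n}"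
  shows "measure N {w \<in> space N. W w \<inter> e ` {..<n} = B} = pattern_weight p e n B"
proof -
  interpret prob_space N by fact
  have ind: "indep_vars (\<lambda>_. count_space UNIV) (\<lambda>n w. n \<in> W w) UNIV"
    and p: "measure N {w \<in> space N. k \<in> W w} = p" for k
    using assms(2) by (auto simp: iid_site_percolation_def)
  have W: "W \<in> measurable N subset_space"
    using assms(1,2) by (rule percolation_measurable)
  have q: "measure N {w \<in> space N. k \<notin> W w} = 1 - p" for k
  proof -
    have "{w \<in> space N. k \<notin> W w} = space N - {w \<in> space N. k \<in> W w}" by auto
    then show ?thesis using prob_compl[OF sets_member_event[OF W, of k]] p[of k] by simp
  qed
  show ?thesis
  proof (cases "n = 0")
    case True
    then show ?thesis using B prob_space by (simp add: pattern_weight_def)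
  next
    case False
    let ?A = "\<lambda>k. if k \<in> B then {True} else {False}"
    have "W w \<inter> e ` {..<n} = B \<longleftrightarrow> (\<forall>k\<in>e ` {..<n}. (k \<in> W w) \<in> ?A k)" for w
      using B by auto
    then have "{w \<in> space N. W w \<inter> e ` {..<n} = B}
        = (\<Inter>k\<in>e ` {..<n}. (\<lambda>w. k \<in> W w) -` ?A k \<inter> space N)"
      using False by blast
    also have "prob \<dots> = (\<Prod>k\<in>e ` {..<n}. prob ((\<lambda>w. k \<in> W w) -` ?A k \<inter> space N))"
      using False by (intro indep_varsD[OF ind]) auto
    also have "\<dots> = (\<Prod>k\<in>e ` {..<n}. if k \<in> B then p else 1 - p)"
      by (rule prod.cong) (simp_all add: vimage_def Int_def conj_commute p q)
    also have "\<dots> = pattern_weight p e n B"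
      unfolding pattern_weight_def by (subst prod.reindex) (auto intro: inj_on_subset[OF e])
    finally show ?thesis .
  qed
qed

section \<open>A sequential criterion for domination by percolation\<close>

definition uniform01 :: "real measure" where
  "uniform01 = uniform_measure lborel {0..1}"

lemma prob_space_uniform01: "prob_space uniform01"
  unfolding uniform01_def by (rule prob_space_uniform_measure) auto

lemma sets_uniform01 [simp, measurable_cong]: "sets uniform01 = sets borel"
  by (simp add: uniform01_def)

lemma space_uniform01 [simp]: "space uniform01 = UNIV"
  by (simp add: uniform01_def)

lemma measure_uniform01_lessThan:
  assumes "0 \<le> q" "q \<le> 1"
  shows "measure uniform01 {..<q} = q"
proof -
  have "{0..1} \<inter> {..<q} = {0..<q}" using assms by auto
  then show ?thesis
    unfolding uniform01_def using assms by (subst measure_uniform_measure) auto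
qed

definition uniform_seq :: "(nat \<Rightarrow> real) measure" where
  "uniform_seq = PiM UNIV (\<lambda>_. uniform01)"

lemma prob_space_uniform_seq: "prob_space uniform_seq"
  unfolding uniform_seq_def by (intro prob_space_PiM prob_space_uniform01)

lemma space_uniform_seq [simp]: "space uniform_seq = UNIV"
  by (simp add: uniform_seq_def space_PiM)

lemma measure_uniform_seq:
  assumes "\<And>i. i < n \<Longrightarrow> S i \<in> sets borel"
  shows "measure uniform_seq {s. \<forall>i<n. s i \<in> S i} = (\<Prod>i<n. measure uniform01 (S i))"
proof -
  interpret U: prob_space uniform01 by (rule prob_space_uniform01)
  interpret product_prob_space "\<lambda>_. uniform01" "UNIV :: nat set" ..
  have "measure uniform_seq (prod_emb UNIV (\<lambda>_. uniform01) {..<n} (Pi\<^sub>E {..<n} S))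
      = (\<Prod>i<n. measure uniform01 (S i))"
    unfolding uniform_seq_def using assms by (intro measure_PiM_emb) auto
  also have "prod_emb UNIV (\<lambda>_. uniform01) {..<n} (Pi\<^sub>E {..<n} S) = {s. \<forall>i<n. s i \<in> S i}"
    by (rule set_eqI) (simp add: prod_emb_def PiE_iff Ball_def)
  finally show ?thesis .
qed

text \<open>The noise variable \<open>s i\<close> decides whether the \<open>i\<close>-th point is added to \<open>C\<close>. The threshold depends on the
trace of \<open>C\<close> on the earlier points only, and not on the points added so far: once this trace is
prescribed, the decisions are conditions on separate noise variables.\<close>
definition fill :: "(nat \<Rightarrow> 'a set \<Rightarrow> real) \<Rightarrow> (nat \<Rightarrow> 'a) \<Rightarrow> 'a set \<Rightarrow> (nat \<Rightarrow> real) \<Rightarrow> 'a set" where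
  "fill q e C s = C \<union> {e i |i. s i < q i (C \<inter> e ` {..<i})}"

text \<open>If the next point belongs to \<open>X\<close> with conditional probability \<open>h \<le> p\<close>, adding it otherwise with
probability \<open>(p - h) / (1 - h)\<close> makes the total exactly \<open>p\<close>. The threshold below is this quotient with
numerator and denominator multiplied by the probability of the trace seen so far, so that traces of
probability zero need no separate treatment. Prescribing the traces of both \<open>X\<close> and the enlarged set on a
window gives a rectangle in the product space; summing its measure over the traces of \<open>X\<close> shows by
induction on the window that the enlarged set has the patterns of a percolation set.\<close>
theorem percolation_coupling:
  fixes X :: "'w \<Rightarrow> 'a set" and e :: "nat \<Rightarrow> 'a"
  assumes M: "prob_space M" and X: "X \<in> measurable M subset_space"
    and e: "bij e" and p: "0 \<le> p" "p \<le> 1"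
    and step: "\<And>n A. A \<subseteq> e ` {..<n} \<Longrightarrow>
      measure M {w \<in> space M. X w \<inter> e ` {..<n} = A \<and> e n \<in> X w}
        \<le> p * measure M {w \<in> space M. X w \<inter> e ` {..<n} = A}"
  obtains W where
    "W \<in> measurable (M \<Otimes>\<^sub>M uniform_seq) subset_space"
    "\<And>w s. X w \<subseteq> W (w, s)"
    "\<And>n B. B \<subseteq> e ` {..<n} \<Longrightarrow>
      measure (M \<Otimes>\<^sub>M uniform_seq)
        {z \<in> space (M \<Otimes>\<^sub>M uniform_seq). W z \<inter> e ` {..<n} = B} = pattern_weight p e n B"
proof -
  interpret M: prob_space M by fact
  interpret U: prob_space uniform_seq by (rule prob_space_uniform_seq)
  interpret MU: pair_prob_space M uniform_seq ..
  have inj: "inj e" and surj: "surj e" using e by (auto simp: bij_def)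
  have new: "e n \<notin> e ` {..<n}" for n using inj by (auto simp: inj_eq)
  define I where "I = (\<lambda>n. e ` {..<n})"
  have I_Suc: "I (Suc n) = insert (e n) (I n)" for n
    by (simp add: I_def lessThan_Suc)
  have I_fin: "finite (I n)" for n by (simp add: I_def)
  have I_new: "e n \<notin> I n" for n using new by (simp add: I_def)
  have I_mono: "I i \<subseteq> I n" if "i \<le> n" for i n using that by (auto simp: I_def)
  define a where "a = (\<lambda>n A. measure M {w \<in> space M. X w \<inter> I n = A})"
  define b where "b = (\<lambda>n A. measure M {w \<in> space M. X w \<inter> I n = A \<and> e n \<in> X w})"
  have pat [measurable]: "{w \<in> space M. X w \<inter> I n = A} \<in> sets M" for n A
    using X I_fin by (rule sets_pattern_event)
  have mem [measurable]: "{w \<in> space M. x \<in> X w} \<in> sets M" for x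
    using X by (rule sets_member_event)
  have b_le_pa: "b n A \<le> p * a n A" if "A \<subseteq> I n" for n A
    using step that unfolding a_def b_def I_def by simp
  have a_nonneg: "0 \<le> a n A" for n A by (simp add: a_def)
  have b_sets: "{w \<in> space M. X w \<inter> I n = A \<and> e n \<in> X w} \<in> sets M" for n A
    using sets.Int[OF pat[of n A] mem[of "e n"]] by (auto simp: Int_def conj_ac cong: conj_cong)
  have b_le_a: "b n A \<le> a n A" for n A
    unfolding a_def b_def by (rule M.finite_measure_mono) (use pat in auto)
  have a_insert: "a (Suc n) (insert (e n) A) = b n A" if "A \<subseteq> I n" for n A
  proof -
    have "X w \<inter> I (Suc n) = insert (e n) A \<longleftrightarrow> X w \<inter> I n = A \<and> e n \<in> X w" for w
      using that I_new[of n] unfolding I_Suc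
      by (cases "e n \<in> X w") (auto dest: insert_ident[THEN iffD1, rotated 2])
    then show ?thesis by (simp add: a_def b_def)
  qed
  have a_same: "a (Suc n) A = a n A - b n A" if "A \<subseteq> I n" for n A
  proof -
    have "{w \<in> space M. X w \<inter> I (Suc n) = A}
        = {w \<in> space M. X w \<inter> I n = A} - {w \<in> space M. X w \<inter> I n = A \<and> e n \<in> X w}"
      using that I_new[of n] unfolding I_Suc by auto
    then show ?thesis
      unfolding a_def b_def by (simp add: M.finite_measure_Diff[OF pat b_sets] subset_iff)
  qed
  define q where "q = (\<lambda>n A. (p * a n A - b n A) / (a n A - b n A))"
  have q: "b n A + (a n A - b n A) * q n A = p * a n A" "0 \<le> q n A" "q n A \<le> 1"
    if "A \<subseteq> I n" for n A
  proof -
    have "p * a n A \<le> a n A" using p a_nonneg[of n A] by (simp add: mult_left_le_one_le)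
    then show "b n A + (a n A - b n A) * q n A = p * a n A" "0 \<le> q n A" "q n A \<le> 1"
      using b_le_pa[OF that] b_le_a[of n A] by (auto simp: q_def divide_le_eq)
  qed
  define W where "W = (\<lambda>(w, s). fill q e (X w) s)"
  \<comment> \<open>The values of \<open>s i\<close> for which the trace \<open>A\<close> of \<open>X\<close> leads to the trace \<open>B\<close> at \<open>e i\<close>.\<close>
  define D where "D = (\<lambda>A B i. if e i \<in> A then (if e i \<in> B then UNIV else {})
    else if e i \<in> B then {..<q i (A \<inter> I i)} else {q i (A \<inter> I i)..})"
  have D_sets: "D A B i \<in> sets borel" for A B i
    by (auto simp: D_def)
  define r where "r = (\<lambda>A B i. measure uniform01 (D A B i))"
  have W_mem: "e i \<in> W (w, s) \<longleftrightarrow> e i \<in> X w \<or> s i < q i (X w \<inter> I i)" for i w s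
    using inj by (auto simp: W_def fill_def I_def inj_eq)
  have rect: "{z \<in> space (M \<Otimes>\<^sub>M uniform_seq). X (fst z) \<inter> I n = A \<and> W z \<inter> I n = B}
      = {w \<in> space M. X w \<inter> I n = A} \<times> {s. \<forall>i<n. s i \<in> D A B i}" (is "?L = ?R")
    if AB: "A \<subseteq> I n" "B \<subseteq> I n" for n A B
  proof -
    have *: "W (w, s) \<inter> I n = B \<longleftrightarrow> (\<forall>i<n. s i \<in> D A B i)" if w: "X w \<inter> I n = A" for w s
    proof -
      have "e i \<in> A \<longleftrightarrow> e i \<in> X w" "X w \<inter> I i = A \<inter> I i" if "i < n" for i
        using w that I_mono[of i n] by (auto simp: I_def)
      then have "(e i \<in> W (w, s) \<longleftrightarrow> e i \<in> B) \<longleftrightarrow> s i \<in> D A B i" if "i < n" for i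
        using that by (auto simp: W_mem D_def)
      moreover have "W (w, s) \<inter> I n = B \<longleftrightarrow> (\<forall>i<n. e i \<in> W (w, s) \<longleftrightarrow> e i \<in> B)"
        using AB by (auto simp: I_def)
      ultimately show ?thesis by auto
    qed
    have "z \<in> ?L \<longleftrightarrow> z \<in> ?R" for z
      using *[of "fst z" "snd z"]
      by (cases z, cases "X (fst z) \<inter> I n = A") (simp_all add: space_pair_measure)
    then show ?thesis by blast
  qed
  have cyl_sets: "{s. \<forall>i<n. s i \<in> D A B i} \<in> sets uniform_seq" for n A B
  proof -
    have [measurable]: "D A B i \<in> sets uniform01" for i using D_sets by simp
    have "{s \<in> space uniform_seq. \<forall>i\<in>{..<n}. s i \<in> D A B i} \<in> sets uniform_seq"
      unfolding uniform_seq_def by measurable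
    then show ?thesis by (simp add: Ball_def)
  qed
  have rect_sets: "{z \<in> space (M \<Otimes>\<^sub>M uniform_seq). X (fst z) \<inter> I n = A \<and> W z \<inter> I n = B}
      \<in> sets (M \<Otimes>\<^sub>M uniform_seq)" if "A \<subseteq> I n" "B \<subseteq> I n" for n A B
    unfolding rect[OF that] using pat cyl_sets by (rule pair_measureI)
  have rect_measure: "measure (M \<Otimes>\<^sub>M uniform_seq)
      {z \<in> space (M \<Otimes>\<^sub>M uniform_seq). X (fst z) \<inter> I n = A \<and> W z \<inter> I n = B}
      = a n A * (\<Prod>i<n. r A B i)" if "A \<subseteq> I n" "B \<subseteq> I n" for n A B
  proof -
    have "measure (M \<Otimes>\<^sub>M uniform_seq) ({w \<in> space M. X w \<inter> I n = A} \<times> {s. \<forall>i<n. s i \<in> D A B i})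
        = a n A * measure uniform_seq {s. \<forall>i<n. s i \<in> D A B i}"
      unfolding measure_def a_def U.emeasure_pair_measure_Times[OF pat cyl_sets] enn2real_mult ..
    then show ?thesis
      unfolding rect[OF that] r_def by (simp add: measure_uniform_seq D_sets)
  qed
  have W_split: "{z \<in> space (M \<Otimes>\<^sub>M uniform_seq). W z \<inter> I n = B}
      = (\<Union>A\<in>Pow (I n). {z \<in> space (M \<Otimes>\<^sub>M uniform_seq). X (fst z) \<inter> I n = A \<and> W z \<inter> I n = B})"
    for n B
  proof (intro equalityI subsetI)
    fix z assume "z \<in> {z \<in> space (M \<Otimes>\<^sub>M uniform_seq). W z \<inter> I n = B}"
    then show "z \<in> (\<Union>A\<in>Pow (I n). {z \<in> space (M \<Otimes>\<^sub>M uniform_seq). X (fst z) \<inter> I n = A \<and> W z \<inter> I n = B})"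
      by (intro UN_I[of "X (fst z) \<inter> I n"]) simp_all
  qed simp
  have W_sets: "{z \<in> space (M \<Otimes>\<^sub>M uniform_seq). W z \<inter> I n = B} \<in> sets (M \<Otimes>\<^sub>M uniform_seq)"
    if "B \<subseteq> I n" for n B
    unfolding W_split[of n B] using that I_fin by (intro sets.finite_UN rect_sets) auto
  have W_measure: "measure (M \<Otimes>\<^sub>M uniform_seq) {z \<in> space (M \<Otimes>\<^sub>M uniform_seq). W z \<inter> I n = B}
      = (\<Sum>A\<in>Pow (I n). a n A * (\<Prod>i<n. r A B i))" if "B \<subseteq> I n" for n B
    unfolding W_split[of n B]
  proof (subst MU.finite_measure_finite_Union)
    show "finite (Pow (I n))" using I_fin by simp
    show "disjoint_family_on (\<lambda>A. {z \<in> space (M \<Otimes>\<^sub>M uniform_seq).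
        X (fst z) \<inter> I n = A \<and> W z \<inter> I n = B}) (Pow (I n))"
      unfolding disjoint_family_on_def by blast
    show "(\<lambda>A. {z \<in> space (M \<Otimes>\<^sub>M uniform_seq).
        X (fst z) \<inter> I n = A \<and> W z \<inter> I n = B}) ` Pow (I n) \<subseteq> sets (M \<Otimes>\<^sub>M uniform_seq)"
      using rect_sets that by blast
  qed (rule sum.cong[OF refl], use rect_measure that in blast)
  have r_cong: "r A B i = r A' B' i" if "A \<inter> I (Suc i) = A' \<inter> I (Suc i)" "e i \<in> B \<longleftrightarrow> e i \<in> B'" for A A' B B' i
  proof -
    have "e i \<in> A \<longleftrightarrow> e i \<in> A'" "A \<inter> I i = A' \<inter> I i" using that(1) by (auto simp: I_Suc)
    then show ?thesis using that(2) by (simp add: r_def D_def)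
  qed
  interpret U01: prob_space uniform01 by (rule prob_space_uniform01)
  have r_in: "r (insert (e n) A) B n = (if e n \<in> B then 1 else 0)" for n A B
    using U01.prob_space by (simp add: r_def D_def)
  have r_out: "r A B n = (if e n \<in> B then q n A else 1 - q n A)" if A: "A \<subseteq> I n" for n A B
  proof -
    have A': "e n \<notin> A" "A \<inter> I n = A" using A I_new[of n] by auto
    have "measure uniform01 {q n A..} = 1 - q n A"
      using U01.prob_compl[of "{..<q n A}"] measure_uniform01_lessThan q[OF A]
      by (simp add: Compl_eq_Diff_UNIV[symmetric])
    then show ?thesis
      using A' measure_uniform01_lessThan q[OF A] by (simp add: r_def D_def)
  qed
  have total: "(\<Sum>A\<in>Pow (I n). a n A * (\<Prod>i<n. r A B i)) = pattern_weight p e n B" for n B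
  proof (induction n)
    case 0
    then show ?case
      using M.prob_space by (simp add: a_def I_def pattern_weight_def)
  next
    case (Suc n)
    let ?R = "\<lambda>A. \<Prod>i<n. r A B i"
    have R: "?R (insert (e n) A) = ?R A" for A
    proof (intro prod.cong refl r_cong)
      fix i assume "i \<in> {..<n}"
      then have "I (Suc i) \<subseteq> I n" by (intro I_mono) simp
      then show "insert (e n) A \<inter> I (Suc i) = A \<inter> I (Suc i)"
        using I_new[of n] by blast
    qed
    have "(\<Sum>A\<in>Pow (I (Suc n)). a (Suc n) A * (\<Prod>i<Suc n. r A B i))
        = (\<Sum>A\<in>Pow (I n). a (Suc n) A * (\<Prod>i<Suc n. r A B i))
        + (\<Sum>A\<in>insert (e n) ` Pow (I n). a (Suc n) A * (\<Prod>i<Suc n. r A B i))"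
      unfolding I_Suc Pow_insert using I_new[of n] I_fin by (intro sum.union_disjoint) auto
    also have "(\<Sum>A\<in>insert (e n) ` Pow (I n). a (Suc n) A * (\<Prod>i<Suc n. r A B i))
        = (\<Sum>A\<in>Pow (I n). b n A * (if e n \<in> B then 1 else 0) * ?R A)"
    proof -
      have "inj_on (insert (e n)) (Pow (I n))"
        using I_new[of n] by (intro inj_onI) (metis PowD insert_ident subsetD)
      then have "(\<Sum>A\<in>insert (e n) ` Pow (I n). a (Suc n) A * (\<Prod>i<Suc n. r A B i))
          = (\<Sum>A\<in>Pow (I n). a (Suc n) (insert (e n) A) * (\<Prod>i<Suc n. r (insert (e n) A) B i))"
        by (simp only: sum.reindex comp_def)
      also have "\<dots> = (\<Sum>A\<in>Pow (I n). b n A * (if e n \<in> B then 1 else 0) * ?R A)"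
        by (rule sum.cong) (simp_all add: a_insert r_in R)
      finally show ?thesis .
    qed
    also have "(\<Sum>A\<in>Pow (I n). a (Suc n) A * (\<Prod>i<Suc n. r A B i))
        = (\<Sum>A\<in>Pow (I n). (a n A - b n A) * (if e n \<in> B then q n A else 1 - q n A) * ?R A)"
      by (intro sum.cong refl) (simp add: a_same r_out)
    also have "\<dots> + (\<Sum>A\<in>Pow (I n). b n A * (if e n \<in> B then 1 else 0) * ?R A)
        = (\<Sum>A\<in>Pow (I n). (if e n \<in> B then p else 1 - p) * (a n A * ?R A))"
      unfolding sum.distrib[symmetric]
    proof (intro sum.cong refl)
      fix A assume "A \<in> Pow (I n)"
      then have *: "b n A + (a n A - b n A) * q n A = p * a n A" using q by auto
      have "(a n A - b n A) * (if e n \<in> B then q n A else 1 - q n A)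
          + b n A * (if e n \<in> B then 1 else 0) = (if e n \<in> B then p else 1 - p) * a n A"
        using * by (simp add: algebra_simps)
      then show "(a n A - b n A) * (if e n \<in> B then q n A else 1 - q n A) * ?R A
          + b n A * (if e n \<in> B then 1 else 0) * ?R A
          = (if e n \<in> B then p else 1 - p) * (a n A * ?R A)"
        by (metis distrib_right mult.assoc)
    qed
    also have "\<dots> = pattern_weight p e (Suc n) B"
      unfolding sum_distrib_left[symmetric] Suc.IH by (simp add: pattern_weight_def)
    finally show ?case .
  qed
  show thesis
  proof
    show "W \<in> measurable (M \<Otimes>\<^sub>M uniform_seq) subset_space"
      unfolding measurable_subset_space_iff
    proof
      fix x
      obtain k where k: "x = e k" using surj by (metis surjD)
      have "{z \<in> space (M \<Otimes>\<^sub>M uniform_seq). x \<in> W z}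
          = (\<Union>B\<in>{B \<in> Pow (I (Suc k)). x \<in> B}. {z \<in> space (M \<Otimes>\<^sub>M uniform_seq). W z \<inter> I (Suc k) = B})"
        by (intro member_event_eq_Union_patterns) (simp add: k I_Suc)
      also have "\<dots> \<in> sets (M \<Otimes>\<^sub>M uniform_seq)"
        using I_fin by (intro sets.finite_UN W_sets) auto
      finally show "{z \<in> space (M \<Otimes>\<^sub>M uniform_seq). x \<in> W z} \<in> sets (M \<Otimes>\<^sub>M uniform_seq)" .
    qed
    show "X w \<subseteq> W (w, s)" for w s
      by (auto simp: W_def fill_def)
    show "measure (M \<Otimes>\<^sub>M uniform_seq) {z \<in> space (M \<Otimes>\<^sub>M uniform_seq). W z \<inter> e ` {..<n} = B}
        = pattern_weight p e n B" if "B \<subseteq> e ` {..<n}" for n B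
      using W_measure[of B n] total[of n B] that by (simp add: I_def)
  qed
qed

text \<open>The coupling is made for a set \<open>X\<close> that lies above a copy \<open>Y\<close> of the set of interest \<open>S\<close> on the same space.
Inserting the smaller set there avoids a transitivity argument for stochastic domination.\<close>
theorem stochastically_dominates_percolationI:
  fixes X :: "'u \<Rightarrow> int set" and Y :: "'u \<Rightarrow> int set"
    and S :: "'w \<Rightarrow> int set" and W :: "'v \<Rightarrow> int set"
    and e :: "nat \<Rightarrow> int"
  assumes L: "prob_space L" and X: "X \<in> measurable L subset_space"
    and e: "bij e"
    and step: "\<And>n A. A \<subseteq> e ` {..<n} \<Longrightarrow>
      measure L {w \<in> space L. X w \<inter> e ` {..<n} = A \<and> e n \<in> X w}
        \<le> p * measure L {w \<in> space L. X w \<inter> e ` {..<n} = A}"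
    and Y: "Y \<in> measurable L subset_space" "\<And>w. Y w \<subseteq> X w"
    and S: "S \<in> measurable M subset_space" "distr L subset_space Y = distr M subset_space S"
    and N: "prob_space N" and W: "iid_site_percolation N W p"
  shows "stochastically_dominates subset_space N W M S"
proof -
  interpret N: prob_space N by fact
  interpret L: prob_space L by fact
  interpret U: prob_space uniform_seq by (rule prob_space_uniform_seq)
  interpret LU: pair_prob_space L uniform_seq ..
  have "p = measure N {w \<in> space N. 0 \<in> W w}"
    using W by (simp add: iid_site_percolation_def)
  then have p: "0 \<le> p" "p \<le> 1" by auto
  obtain V where V: "V \<in> measurable (L \<Otimes>\<^sub>M uniform_seq) subset_space"
    and XV: "\<And>w s. X w \<subseteq> V (w, s)"
    and V_pattern: "\<And>n B. B \<subseteq> e ` {..<n} \<Longrightarrow> measure (L \<Otimes>\<^sub>M uniform_seq)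
        {z \<in> space (L \<Otimes>\<^sub>M uniform_seq). V z \<inter> e ` {..<n} = B} = pattern_weight p e n B"
    using percolation_coupling[OF L X e p step] by blast
  have W_meas: "W \<in> measurable N subset_space"
    using N W by (rule percolation_measurable)
  have inj: "inj e" and surj: "surj e" using e by (auto simp: bij_def)
  show ?thesis
  proof (rule stochastically_dominatesI[OF W_meas S(1)])
    show "prob_space (L \<Otimes>\<^sub>M uniform_seq)" by (rule LU.prob_space_axioms)
    show "V \<in> measurable (L \<Otimes>\<^sub>M uniform_seq) subset_space" by fact
    show "(\<lambda>z. Y (fst z)) \<in> measurable (L \<Otimes>\<^sub>M uniform_seq) subset_space"
      using Y(1) by measurable
    show "distr (L \<Otimes>\<^sub>M uniform_seq) subset_space V = distr N subset_space W"
      by (rule distr_subset_space_eqI[OF LU.prob_space_axioms N V W_meas surj])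
        (simp add: V_pattern percolation_pattern[OF N W inj])
    have "distr (L \<Otimes>\<^sub>M uniform_seq) subset_space (\<lambda>z. Y (fst z))
        = distr (distr (L \<Otimes>\<^sub>M uniform_seq) L fst) subset_space Y"
      using Y(1) by (subst distr_distr) (auto simp: comp_def)
    also have "distr (L \<Otimes>\<^sub>M uniform_seq) L fst = L"
      by (rule U.distr_pair_fst)
    finally show "distr (L \<Otimes>\<^sub>M uniform_seq) subset_space (\<lambda>z. Y (fst z)) = distr M subset_space S"
      using S(2) by simp
    show "AE z in L \<Otimes>\<^sub>M uniform_seq. Y (fst z) \<le> V z"
      using Y(2) XV by (intro AE_I2) (metis prod.collapse subset_trans)
  qed
qed

section \<open>Renewal sequences with geometrically decreasing increments\<close>

text \<open>In probabilistic terms \<open>u j\<close> is the probability of a renewal at time \<open>j\<close>, \<open>T m\<close> is the probability that the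
first gap exceeds \<open>m\<close>, and \<open>v\<close> is the density of renewals. The renewal equation says that there is a last
renewal up to time \<open>m\<close>.\<close>
locale renewal_sequence =
  fixes u T :: "nat \<Rightarrow> real" and t v :: real
  assumes u_0: "u 0 = 1"
    and t_nonneg: "0 \<le> t"
    and u_tendsto: "u \<longlonglongrightarrow> v"
    and v_nonneg: "0 \<le> v"
    and u_decreasing: "u (Suc j) \<le> u j"
    and increments: "u (Suc j) - u (Suc (Suc j)) \<le> t * (u j - u (Suc j))"
    and T_nonneg: "0 \<le> T m"
    and renewal: "(\<Sum>j\<le>m. u j * T (m - j)) = 1"
begin

lemma T_0: "T 0 = 1"
  using renewal[of 0] u_0 by simp

lemma T_Suc: "T (Suc m) = (\<Sum>j\<le>m. (u j - u (Suc j)) * T (m - j))"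
proof -
  have "1 = T (Suc m) + (\<Sum>j\<le>m. u (Suc j) * T (m - j))"
    using renewal[of "Suc m"] unfolding sum.atMost_Suc_shift by (simp add: u_0)
  with renewal[of m] show ?thesis
    by (simp add: algebra_simps sum_subtractf)
qed

text \<open>Compared with the expansion of \<open>T m\<close>, each increment in the expansion of \<open>T (Suc m)\<close> is shifted by one
place and thus shrinks by the factor \<open>t\<close>; only the first term \<open>1 - u 1\<close> has no counterpart.\<close>
lemma T_Suc_le: "T (Suc m) \<le> (1 - u 1 + t) * T m"
proof (cases m)
  case 0
  then show ?thesis using T_Suc[of 0] t_nonneg by (simp add: T_0 u_0)
next
  case (Suc n)
  have "T (Suc m) = (1 - u 1) * T m + (\<Sum>j\<le>n. (u (Suc j) - u (Suc (Suc j))) * T (n - j))"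
    unfolding T_Suc[of m] unfolding Suc sum.atMost_Suc_shift by (simp add: u_0)
  also have "(\<Sum>j\<le>n. (u (Suc j) - u (Suc (Suc j))) * T (n - j))
      \<le> (\<Sum>j\<le>n. t * (u j - u (Suc j)) * T (n - j))"
    by (intro sum_mono mult_right_mono increments T_nonneg)
  also have "\<dots> = t * T m"
    unfolding Suc T_Suc[of n] by (simp add: sum_distrib_left mult.assoc)
  finally show ?thesis by (simp add: algebra_simps)
qed

text \<open>The excess \<open>u j - v\<close> is the sum of all later increments and inherits their geometric decrease. To avoid
infinite sums, the difference of both sides is seen to decrease to zero.\<close>
lemma excess_Suc_le: "u (Suc j) - v \<le> t * (u j - v)"
proof -
  define e where "e = (\<lambda>j. t * (u j - v) - (u (Suc j) - v))"
  have "decseq e"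
    unfolding decseq_Suc_iff e_def using increments by (auto simp: algebra_simps)
  moreover have "e \<longlonglongrightarrow> t * (v - v) - (v - v)"
    unfolding e_def
    by (intro tendsto_intros u_tendsto LIMSEQ_Suc[OF u_tendsto])
  ultimately have "0 \<le> e j"
    using decseq_ge[of e 0 j] by simp
  then show ?thesis by (simp add: e_def)
qed

lemma excess_nonneg: "0 \<le> u j - v"
  using decseq_ge[OF _ u_tendsto] u_decreasing by (simp add: decseq_Suc_iff)

text \<open>For a stationary process the probability of no renewal among \<open>m\<close> consecutive times is
\<open>1 - v * (\<Sum>i<m. T i)\<close>. Rewriting it with the excess in place of \<open>u\<close> gives a sum of nonnegative terms that
can be compared term by term, as for \<open>T\<close>.\<close>
lemma delayed_eq:
  "1 - v * (\<Sum>i<m. T i) = (\<Sum>j\<le>m. (u j - v) * T (m - j)) + v * T m"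
proof -
  have "(\<Sum>j\<le>m. T (m - j)) = (\<Sum>i\<le>m. T i)"
    by (rule sum.reindex_bij_witness[where i="\<lambda>i. m - i" and j="\<lambda>i. m - i"]) auto
  also have "\<dots> = (\<Sum>i<m. T i) + T m"
    by (simp flip: lessThan_Suc_atMost)
  finally have "(\<Sum>j\<le>m. (u j - v) * T (m - j)) = 1 - v * ((\<Sum>i<m. T i) + T m)"
    using renewal[of m] by (simp add: left_diff_distrib sum_subtractf flip: sum_distrib_left)
  then show ?thesis by (simp add: algebra_simps)
qed

lemma delayed_Suc_le:
  "1 - v * (\<Sum>i<Suc m. T i) \<le> (1 - u 1 + 2 * t) * (1 - v * (\<Sum>i<m. T i))"
proof -
  define D where "D = (\<lambda>m. 1 - v * (\<Sum>i<m. T i))"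
  define E where "E = (\<Sum>j\<le>m. (u j - v) * T (m - j))"
  have D: "D m = E + v * T m"
    unfolding D_def E_def by (rule delayed_eq)
  have "D (Suc m) = T (Suc m) + (\<Sum>j\<le>m. (u (Suc j) - v) * T (m - j))"
    unfolding D_def delayed_eq sum.atMost_Suc_shift by (simp add: u_0 algebra_simps)
  also have "(\<Sum>j\<le>m. (u (Suc j) - v) * T (m - j)) \<le> (\<Sum>j\<le>m. t * (u j - v) * T (m - j))"
    by (intro sum_mono mult_right_mono excess_Suc_le T_nonneg)
  also have "\<dots> = t * E"
    by (simp add: E_def sum_distrib_left mult.assoc)
  also have "T (Suc m) \<le> (1 - u 1 + t) * T m"
    by (rule T_Suc_le)
  finally have le: "D (Suc m) \<le> (1 - u 1 + t) * T m + t * E"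
    by simp
  have "(u 0 - v) * T (m - 0) \<le> E"
    unfolding E_def by (intro member_le_sum mult_nonneg_nonneg excess_nonneg T_nonneg) auto
  then have "T m \<le> D m"
    by (simp add: D u_0 algebra_simps)
  moreover have "0 \<le> 1 - u 1 + t"
    using u_decreasing[of 0] t_nonneg by (simp add: u_0)
  ultimately have "(1 - u 1 + t) * T m \<le> (1 - u 1 + t) * D m"
    by (intro mult_left_mono)
  moreover have "t * E \<le> t * D m"
    using t_nonneg v_nonneg T_nonneg[of m] by (intro mult_left_mono) (auto simp: D)
  ultimately show ?thesis
    using le unfolding D_def by (simp add: algebra_simps)
qed

end

section \<open>Points covered by intervals with integer and half-integer centres\<close>

text \<open>The index \<open>n\<close> stands for the centre \<open>n/2\<close>, and distances are doubled. The centre covers the integers at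
distance at most \<open>g n / 2 - 1\<close> from it.\<close>
definition cover :: "(int \<Rightarrow> nat) \<Rightarrow> int set" where
  "cover g = {k. \<exists>n. \<bar>2 * k - n\<bar> + 2 \<le> int (g n)}"

text \<open>The centres in \<open>L\<close> leave \<open>z\<close> uncovered, and within \<open>K\<close> they cover exactly the points of \<open>A\<close>. Once \<open>z\<close> is
known to be uncovered, the centres on one side of \<open>z\<close> act on the points of that side only, so that events
concerning the two sides become conditions of this form on disjoint sets of centres.\<close>
definition side :: "int set \<Rightarrow> int \<Rightarrow> int set \<Rightarrow> int set \<Rightarrow> (int \<Rightarrow> nat) \<Rightarrow> bool" where
  "side L z K A g \<longleftrightarrow> (\<forall>n\<in>L. int (g n) < \<bar>2 * z - n\<bar> + 2) \<and>
     (\<forall>k\<in>K. (\<exists>n\<in>L. \<bar>2 * k - n\<bar> + 2 \<le> int (g n)) \<longleftrightarrow> k \<in> A)"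

lemma side_restrict: "side L z K A (restrict g L) \<longleftrightarrow> side L z K A g"
  by (simp add: side_def cong: ball_cong bex_cong)

lemma sets_side:
  "{g \<in> space (PiM L (\<lambda>_. count_space UNIV)). side L z K A g} \<in> sets (PiM L (\<lambda>_. count_space UNIV))"
proof -
  let ?P = "PiM L (\<lambda>_. count_space UNIV :: nat measure)"
  have component: "Measurable.pred ?P (\<lambda>g. Q (g n))" if "n \<in> L" for n Q
  proof -
    have "(\<lambda>g. g n) \<in> measurable ?P (count_space UNIV)"
      using measurable_component_singleton[OF that, of "\<lambda>_. count_space UNIV :: nat measure"] .
    then show ?thesis by (rule measurable_compose) simp
  qed
  have all: "Measurable.pred ?P (\<lambda>g. \<forall>n\<in>L. Q n (g n))" for Q
    by (rule pred_intros_countable_bounded) (auto intro: component)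
  have ex: "Measurable.pred ?P (\<lambda>g. \<exists>n\<in>L. Q n (g n))" for Q
    by (rule pred_intros_countable_bounded) (auto intro: component)
  have pattern: "Measurable.pred ?P (\<lambda>g. \<forall>k\<in>K. (\<exists>n\<in>L. Q k n (g n)) \<longleftrightarrow> k \<in> A)" for Q
    by (rule pred_intros_countable_bounded) (auto intro!: pred_intros_logic ex)
  have "Measurable.pred ?P (side L z K A)"
    unfolding side_def by (intro pred_intros_logic(3) all pattern)
  then show ?thesis by (simp add: pred_def)
qed

lemma uncovered_split:
  assumes "A\<^sub>1 \<subseteq> K\<^sub>1" "K\<^sub>1 \<subseteq> {..<z}" "A\<^sub>2 \<subseteq> K\<^sub>2" "K\<^sub>2 \<subseteq> {z<..}"
  shows "z \<notin> cover g \<and> cover g \<inter> K\<^sub>1 = A\<^sub>1 \<and> cover g \<inter> K\<^sub>2 = A\<^sub>2 \<longleftrightarrow>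
    side {..<2 * z} z K\<^sub>1 A\<^sub>1 g \<and> side {2 * z..} z K\<^sub>2 A\<^sub>2 g"
proof (cases "z \<in> cover g")
  case True
  then obtain n where "\<bar>2 * z - n\<bar> + 2 \<le> int (g n)" by (auto simp: cover_def)
  then have "\<not> side L z K A g" if "n \<in> L" for L K A
    using that unfolding side_def by (meson not_le)
  moreover have "n \<in> {..<2 * z} \<or> n \<in> {2 * z..}" by auto
  ultimately show ?thesis using True by blast
next
  case False
  then have g: "int (g n) < \<bar>2 * z - n\<bar> + 2" for n by (auto simp: cover_def not_le)
  have left: "k \<in> cover g \<longleftrightarrow> (\<exists>n\<in>{..<2 * z}. \<bar>2 * k - n\<bar> + 2 \<le> int (g n))" if "k < z" for k
  proof -
    have "n < 2 * z" if "\<bar>2 * k - n\<bar> + 2 \<le> int (g n)" for n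
      using g[of n] that \<open>k < z\<close> by linarith
    then show ?thesis by (auto simp: cover_def)
  qed
  have right: "k \<in> cover g \<longleftrightarrow> (\<exists>n\<in>{2 * z..}. \<bar>2 * k - n\<bar> + 2 \<le> int (g n))" if "z < k" for k
  proof -
    have "2 * z \<le> n" if "\<bar>2 * k - n\<bar> + 2 \<le> int (g n)" for n
      using g[of n] that \<open>z < k\<close> by linarith
    then show ?thesis by (auto simp: cover_def)
  qed
  have "cover g \<inter> K\<^sub>1 = A\<^sub>1 \<longleftrightarrow> (\<forall>k\<in>K\<^sub>1. k \<in> cover g \<longleftrightarrow> k \<in> A\<^sub>1)"
    and "cover g \<inter> K\<^sub>2 = A\<^sub>2 \<longleftrightarrow> (\<forall>k\<in>K\<^sub>2. k \<in> cover g \<longleftrightarrow> k \<in> A\<^sub>2)"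
    using assms by blast+
  moreover have side: "side L z K A g \<longleftrightarrow> (\<forall>k\<in>K. (\<exists>n\<in>L. \<bar>2 * k - n\<bar> + 2 \<le> int (g n)) \<longleftrightarrow> k \<in> A)" for L K A
    unfolding side_def using g by blast
  moreover have "(\<forall>k\<in>K\<^sub>1. k \<in> cover g \<longleftrightarrow> k \<in> A\<^sub>1) \<longleftrightarrow> side {..<2 * z} z K\<^sub>1 A\<^sub>1 g"
    using assms(2) by (simp add: side left subset_iff)
  moreover have "(\<forall>k\<in>K\<^sub>2. k \<in> cover g \<longleftrightarrow> k \<in> A\<^sub>2) \<longleftrightarrow> side {2 * z..} z K\<^sub>2 A\<^sub>2 g"
    using assms(4) by (simp add: side right subset_iff)
  ultimately show ?thesis using False by blast
qed

text \<open>The bound \<open>1/2\<close> on \<open>t\<close> serves to bound the infinite product giving the density of uncovered points away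
from zero by elementary means.\<close>
locale geometric_cover = prob_space +
  fixes \<Gamma> :: "int \<Rightarrow> 'a \<Rightarrow> nat" and t :: real
  assumes indep: "indep_vars (\<lambda>_. count_space UNIV) \<Gamma> UNIV"
    and tail: "prob {w \<in> space M. \<Gamma> n w < r} = 1 - t ^ r"
    and t_pos: "0 < t" and t_le: "t \<le> 1 / 2"
begin

definition covered :: "'a \<Rightarrow> int set" where
  "covered w = cover (\<lambda>n. \<Gamma> n w)"

lemma measurable_\<Gamma> [measurable]: "\<Gamma> n \<in> measurable M (count_space UNIV)"
  using indep by (auto simp: indep_vars_def)

lemma pred_\<Gamma>: "Measurable.pred M (\<lambda>w. Q (\<Gamma> n w))"
  using measurable_\<Gamma> by (rule measurable_compose) simp

lemma pred_covered [measurable]: "Measurable.pred M (\<lambda>w. k \<in> covered w)"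
  unfolding covered_def cover_def mem_Collect_eq by (intro pred_intros_countable pred_\<Gamma>)

lemma prob_side_product:
  "prob {w \<in> space M. side {..<2 * z} z K\<^sub>1 A\<^sub>1 (\<lambda>n. \<Gamma> n w) \<and> side {2 * z..} z K\<^sub>2 A\<^sub>2 (\<lambda>n. \<Gamma> n w)}
    = prob {w \<in> space M. side {..<2 * z} z K\<^sub>1 A\<^sub>1 (\<lambda>n. \<Gamma> n w)}
    * prob {w \<in> space M. side {2 * z..} z K\<^sub>2 A\<^sub>2 (\<lambda>n. \<Gamma> n w)}"
proof -
  let ?L = "{..<2 * z}" and ?R = "{2 * z..}"
  let ?P = "\<lambda>L. PiM L (\<lambda>_. count_space UNIV :: nat measure)"
  let ?res = "\<lambda>L w. restrict (\<lambda>n. \<Gamma> n w) L"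
  let ?S = "\<lambda>L K A. {g \<in> space (?P L). side L z K A g}"
  have *: "?res L w \<in> ?S L K A \<longleftrightarrow> side L z K A (\<lambda>n. \<Gamma> n w)" for L K A w
    by (simp add: side_restrict space_PiM)
  have "?res L -` ?S L K A \<inter> space M = {w \<in> space M. side L z K A (\<lambda>n. \<Gamma> n w)}" for L K A
    unfolding vimage_def * by blast
  moreover have "(\<lambda>w. (?res ?L w, ?res ?R w)) -` (?S ?L K\<^sub>1 A\<^sub>1 \<times> ?S ?R K\<^sub>2 A\<^sub>2) \<inter> space M
      = {w \<in> space M. side ?L z K\<^sub>1 A\<^sub>1 (\<lambda>n. \<Gamma> n w) \<and> side ?R z K\<^sub>2 A\<^sub>2 (\<lambda>n. \<Gamma> n w)}"
    unfolding vimage_def mem_Times_iff fst_conv snd_conv * by blast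
  moreover  have "indep_var (?P ?L) (?res ?L) (?P ?R) (?res ?R)"
    by (rule indep_var_restrict[OF indep]) auto
  note indep_varD[OF this sets_side[of ?L z K\<^sub>1 A\<^sub>1] sets_side[of ?R z K\<^sub>2 A\<^sub>2]]
  ultimately show ?thesis by (simp only:)
qed

text \<open>Conditional independence of the two sides of an uncovered point, in multiplied-out form. Each of the four
probabilities is a product of one factor per side.\<close>
lemma uncovered_indep:
  assumes "A\<^sub>1 \<subseteq> K\<^sub>1" "K\<^sub>1 \<subseteq> {..<z}" "A\<^sub>2 \<subseteq> K\<^sub>2" "K\<^sub>2 \<subseteq> {z<..}"
  shows "prob {w \<in> space M. z \<notin> covered w \<and> covered w \<inter> K\<^sub>1 = A\<^sub>1 \<and> covered w \<inter> K\<^sub>2 = A\<^sub>2} * prob {w \<in> space M. z \<notin> covered w}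
    = prob {w \<in> space M. z \<notin> covered w \<and> covered w \<inter> K\<^sub>1 = A\<^sub>1} * prob {w \<in> space M. z \<notin> covered w \<and> covered w \<inter> K\<^sub>2 = A\<^sub>2}"
proof -
  define l where "l = (\<lambda>K A. prob {w \<in> space M. side {..<2 * z} z K A (\<lambda>n. \<Gamma> n w)})"
  define r where "r = (\<lambda>K A. prob {w \<in> space M. side {2 * z..} z K A (\<lambda>n. \<Gamma> n w)})"
  have "prob {w \<in> space M. z \<notin> covered w \<and> covered w \<inter> K\<^sub>1 = A\<^sub>1 \<and> covered w \<inter> K\<^sub>2 = A\<^sub>2} = l K\<^sub>1 A\<^sub>1 * r K\<^sub>2 A\<^sub>2"
    if "A\<^sub>1 \<subseteq> K\<^sub>1" "K\<^sub>1 \<subseteq> {..<z}" "A\<^sub>2 \<subseteq> K\<^sub>2" "K\<^sub>2 \<subseteq> {z<..}" for K\<^sub>1 A\<^sub>1 K\<^sub>2 A\<^sub>2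
    unfolding covered_def uncovered_split[OF that] prob_side_product l_def r_def ..
  from this[OF assms] this[of "{}" "{}" "{}" "{}"] this[of A\<^sub>1 K\<^sub>1 "{}" "{}"] this[of "{}" "{}" A\<^sub>2 K\<^sub>2]
  show ?thesis using assms by simp
qed

end

section \<open>The uncovered points form a renewal process\<close>

context geometric_cover
begin

text \<open>The probability that a centre at doubled distance \<open>d\<close> from a point does not cover it.\<close>
definition miss :: "nat \<Rightarrow> real" where
  "miss d = 1 - t ^ (d + 2)"

definition prod_from_0 :: "nat \<Rightarrow> real" where
  "prod_from_0 n = (\<Prod>d<n. miss d)"

definition prod_from_1 :: "nat \<Rightarrow> real" where
  "prod_from_1 n = (\<Prod>d\<in>{1..n}. miss d)"

text \<open>For uncovered points at distance \<open>j\<close>, each centre is constrained by the nearer point. Of the centres after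
the left point and up to the right one, the first half is at doubled distances \<open>1, \<dots>, j\<close> from the left
point, the second half at doubled distances \<open>0, \<dots>, j - 1\<close> from the right one. All remaining centres contribute what they do for a single uncovered
point, which explains the conditional probability \<open>u j\<close>. The density \<open>v\<close> of uncovered points is given by the
same product with both ranges extended to infinity.\<close>
definition u :: "nat \<Rightarrow> real" where
  "u j = prod_from_0 j * prod_from_1 j"

definition v :: real where
  "v = lim u"

lemma power_le_half: "t ^ Suc d \<le> 1 / 2"
  using power_le_one[of t d] t_pos t_le mult_mono[of t "1/2" "t ^ d" 1] by simp

lemma miss_bounds: "1 / 2 \<le> miss d" "miss d \<le> 1"
  using power_le_half[of "Suc d"] t_pos by (simp_all add: miss_def)

lemma prod_from_0_Suc: "prod_from_0 (Suc n) = prod_from_0 n * miss n"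
  by (simp add: prod_from_0_def)

lemma prod_from_1_Suc: "prod_from_1 (Suc n) = prod_from_1 n * miss (Suc n)"
  by (simp add: prod_from_1_def)

lemma prod_from_0_Suc_eq_prod_from_1: "prod_from_0 (Suc n) = miss 0 * prod_from_1 n"
  by (induction n) (simp_all add: prod_from_0_Suc prod_from_1_Suc, simp add: prod_from_0_def prod_from_1_def)

lemma prod_from_0_nonneg: "0 \<le> prod_from_0 n" and prod_from_1_nonneg: "0 \<le> prod_from_1 n"
  unfolding prod_from_0_def prod_from_1_def using miss_bounds(1) by (auto intro!: prod_nonneg order_trans[OF _ miss_bounds(1)])

text \<open>This form of the lower bound is made for induction: passing from \<open>n\<close> to \<open>n + 1\<close> costs at most \<open>t^(n + 2)\<close>, and
the bound decreases by \<open>t^(n + 1) - t^(n + 2)\<close>, which is larger because \<open>t \<le> 1/2\<close>.\<close>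
lemma prod_from_0_ge: "1 - t * (1 - t ^ n) \<le> prod_from_0 n"
proof (induction n)
  case (Suc n)
  have "t ^ n * t \<ge> 2 * (t ^ n * t * t)"
    using mult_left_mono[OF t_le, of "t ^ n * t"] t_pos by simp
  moreover have "prod_from_0 n \<le> 1"
    unfolding prod_from_0_def by (intro prod_le_1) (use miss_bounds in \<open>auto intro: order_trans[OF _ miss_bounds(1)]\<close>)
  then have "prod_from_0 n * t ^ (n + 2) \<le> t ^ (n + 2)"
    using t_pos by (simp add: mult_left_le_one_le)
  ultimately show ?case
    using Suc unfolding prod_from_0_Suc miss_def by (simp add: algebra_simps)
qed (simp add: prod_from_0_def)

lemma prod_from_0_ge_half: "1 / 2 \<le> prod_from_0 n"
proof -
  have "t * (1 - t ^ n) \<le> t * 1" using t_pos by (intro mult_left_mono) auto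
  then show ?thesis using prod_from_0_ge[of n] t_le by simp
qed

lemma prod_from_1_ge_half: "1 / 2 \<le> prod_from_1 n"
proof -
  have "miss 0 * prod_from_1 n \<le> 1 * prod_from_1 n" using miss_bounds prod_from_1_nonneg by (intro mult_right_mono)
  then show ?thesis using prod_from_0_ge_half[of "Suc n"] by (simp add: prod_from_0_Suc_eq_prod_from_1)
qed

lemma decseq_prod_from_0: "decseq prod_from_0" and decseq_prod_from_1: "decseq prod_from_1"
  unfolding decseq_Suc_iff prod_from_0_Suc prod_from_1_Suc
  using prod_from_0_nonneg prod_from_1_nonneg miss_bounds(2) by (auto intro: mult_left_le)

lemma u_tendsto: "u \<longlonglongrightarrow> v"
  and void_tendsto: "(\<lambda>N. prod_from_0 (Suc N) * prod_from_1 N) \<longlonglongrightarrow> v"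
  and v_pos: "0 < v"
proof -
  obtain a where a: "prod_from_0 \<longlonglongrightarrow> a"
    by (metis decseq_convergent decseq_prod_from_0 prod_from_0_nonneg)
  obtain b where b: "prod_from_1 \<longlonglongrightarrow> b"
    by (metis decseq_convergent decseq_prod_from_1 prod_from_1_nonneg)
  have u: "u \<longlonglongrightarrow> a * b"
    unfolding u_def[abs_def] using a b by (rule tendsto_mult)
  then have v: "v = a * b" unfolding v_def by (rule limI)
  have "1 / 2 \<le> a" by (rule LIMSEQ_le_const[OF a]) (intro exI allI impI prod_from_0_ge_half)
  moreover have "1 / 2 \<le> b" by (rule LIMSEQ_le_const[OF b]) (intro exI allI impI prod_from_1_ge_half)
  ultimately show "0 < v" unfolding v by (intro mult_pos_pos) auto
  show "u \<longlonglongrightarrow> v" using u v by simp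
  show "(\<lambda>N. prod_from_0 (Suc N) * prod_from_1 N) \<longlonglongrightarrow> v"
    unfolding v using LIMSEQ_Suc[OF a] b by (rule tendsto_mult)
qed

lemma u_0: "u 0 = 1"
  by (simp add: u_def prod_from_0_def prod_from_1_def)

lemma u_nonneg: "0 \<le> u j"
  by (simp add: u_def prod_from_0_nonneg prod_from_1_nonneg)

lemma u_Suc: "u (Suc j) = u j * (miss j * miss (Suc j))"
  by (simp add: u_def prod_from_0_Suc prod_from_1_Suc)

lemma one_minus_u_1: "1 - u 1 \<le> 2 * t"
proof -
  have "1 - u 1 = t\<^sup>2 + t ^ 3 - t ^ 5"
    using u_Suc[of 0] unfolding u_0 miss_def
    by (simp add: algebra_simps power2_eq_square power3_eq_cube numeral_eq_Suc)
  also have "\<dots> \<le> t * t + t * t"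
  proof -
    have "t ^ 3 \<le> t\<^sup>2" "0 < t ^ 5"
      using t_pos t_le by (auto intro: power_decreasing)
    then show ?thesis by (simp only: power2_eq_square)
  qed
  also have "\<dots> \<le> t * (1/2) + t * (1/2)"
    using t_pos t_le by (intro add_mono mult_left_mono) auto
  finally show ?thesis using t_pos by simp
qed

text \<open>With \<open>a = t^(j + 2)\<close>, \<open>u\<close> loses the fraction \<open>x = a + t a - t a^2\<close> of its value at step \<open>j\<close> and the fraction \<open>y\<close>,
the same expression with \<open>t a\<close> for \<open>a\<close>, at the next step. The claim is \<open>(1 - x) * y \<le> t * x\<close>. Here \<open>y\<close> is
slightly larger than \<open>t * x\<close>, but the difference \<open>(t a)^2 * (1 - t)\<close> is smaller than \<open>x * y\<close>, which is
at least \<open>a * t a\<close>.\<close>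
lemma u_increments: "u (Suc j) - u (Suc (Suc j)) \<le> t * (u j - u (Suc j))"
proof -
  define a where "a = t ^ (j + 2)"
  have a: "0 < a" "a \<le> 1/2" using t_pos power_le_half[of "Suc j"] by (auto simp: a_def)
  have miss: "miss j = 1 - a" "miss (Suc j) = 1 - t * a" "miss (Suc (Suc j)) = 1 - t * t * a"
    by (simp_all add: miss_def a_def)
  define x where "x = 1 - miss j * miss (Suc j)"
  define y where "y = 1 - miss (Suc j) * miss (Suc (Suc j))"
  have x: "x = a + t * a - t * a * a" and y: "y = t * a + t * t * a - t * t * t * a * a"
    by (simp_all add: x_def y_def miss algebra_simps)
  have "y - t * x = t * a * (t * a) * (1 - t)"
    by (simp add: x y algebra_simps)
  also have "\<dots> \<le> a * (t * a)"
  proof -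
    have "t * a * (t * a) * (1 - t) \<le> t * a * (t * a) * 1"
      using t_pos a by (intro mult_left_mono) auto
    also have "\<dots> = t * (a * (t * a))" by simp
    also have "\<dots> \<le> 1 * (a * (t * a))" using t_pos t_le a by (intro mult_right_mono) auto
    finally show ?thesis by simp
  qed
  also have "\<dots> \<le> x * y"
  proof (rule mult_mono)
    show "a \<le> x" using t_pos a mult_left_mono[of a 1 "t * a"] by (simp add: x)
    have "t * t * t * a * a = (t * t * a) * (t * a)" by simp
    also have "\<dots> \<le> (t * t * a) * 1"
      using t_pos a t_le by (intro mult_left_mono mult_le_one) auto
    finally show "t * a \<le> y" by (simp add: y)
    show "0 \<le> x" using \<open>a \<le> x\<close> a by simp
  qed (use t_pos a in auto)
  finally have "(1 - x) * y \<le> t * x" by (simp add: algebra_simps)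
  then have "u j * ((1 - x) * y) \<le> u j * (t * x)"
    by (intro mult_left_mono u_nonneg)
  moreover have "u j - u (Suc j) = u j * x" "u (Suc j) - u (Suc (Suc j)) = u j * ((1 - x) * y)"
    by (simp_all add: u_Suc x_def y_def algebra_simps)
  ultimately show ?thesis by (simp only: mult.left_commute)
qed

lemma u_decreasing: "u (Suc j) \<le> u j"
  unfolding u_Suc using u_nonneg miss_bounds(2) miss_bounds(1)
  by (intro mult_left_le mult_le_one) (auto intro: order_trans[OF _ miss_bounds(1)])

lemma prob_all_less_tendsto:
  fixes F :: "nat \<Rightarrow> int set" and c :: "int \<Rightarrow> nat"
  assumes F: "\<And>N. finite (F N)" "\<And>N. F N \<noteq> {}" "incseq F" "(\<Union>N. F N) = UNIV"
  shows "(\<lambda>N. \<Prod>n\<in>F N. 1 - t ^ c n) \<longlonglongrightarrow> prob {w \<in> space M. \<forall>n. \<Gamma> n w < c n}"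
proof -
  let ?A = "\<lambda>N. {w \<in> space M. \<forall>n\<in>F N. \<Gamma> n w < c n}"
  have "?A N \<in> events" for N
  proof -
    have "Measurable.pred M (\<lambda>w. \<forall>n\<in>F N. \<Gamma> n w < c n)"
      by (intro pred_intros_countable_bounded pred_\<Gamma>)
    then show ?thesis by (simp add: pred_def)
  qed
  moreover have "decseq ?A" using F(3) by (fastforce simp: decseq_def incseq_def)
  ultimately have "(\<lambda>N. prob (?A N)) \<longlonglongrightarrow> prob (\<Inter>N. ?A N)"
    by (intro finite_Lim_measure_decseq) auto
  moreover have "(\<Inter>N. ?A N) = {w \<in> space M. \<forall>n. \<Gamma> n w < c n}"
    using F(4) by blast
  moreover have "prob (?A N) = (\<Prod>n\<in>F N. 1 - t ^ c n)" for N
  proof -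
    have "?A N = (\<Inter>n\<in>F N. \<Gamma> n -` {..<c n} \<inter> space M)"
      using F(2)[of N] by auto
    also have "prob \<dots> = (\<Prod>n\<in>F N. prob (\<Gamma> n -` {..<c n} \<inter> space M))"
      using F by (intro indep_varsD[OF indep]) auto
    also have "\<dots> = (\<Prod>n\<in>F N. 1 - t ^ c n)"
      by (intro prod.cong refl) (simp add: tail vimage_def Int_def conj_commute)
    finally show ?thesis .
  qed
  ultimately show ?thesis by simp
qed

text \<open>The window is cut at \<open>2 z\<close>, at the midpoint \<open>2 z + j\<close> and at \<open>2 z + 2 j\<close>; on each of the four pieces the
nearer of the two points is fixed and the distances to it run through consecutive integers.\<close>
lemma void_product:
  "(\<Prod>n\<in>{2 * z - int N..2 * (z + int j) + int N}. 1 - t ^ (nat (min \<bar>2 * z - n\<bar> \<bar>2 * (z + int j) - n\<bar>) + 2))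
    = (prod_from_0 (Suc N) * prod_from_1 N) * u j"
    (is "prod ?g _ = _")
proof -
  let ?A = "{2 * z - int N..2 * z}" and ?B = "{2 * z <..2 * z + int j}"
    and ?C = "{2 * z + int j<..2 * z + 2 * int j}"
    and ?D = "{2 * z + 2 * int j<..2 * z + 2 * int j + int N}"
  have "{2 * z - int N..2 * (z + int j) + int N} = ?A \<union> (?B \<union> (?C \<union> ?D))"
    by auto
  then have "prod ?g {2 * z - int N..2 * (z + int j) + int N}
      = prod ?g ?A * (prod ?g ?B * (prod ?g ?C * prod ?g ?D))"
    by (simp only:) (subst prod.union_disjoint, simp_all, force,
      subst prod.union_disjoint, simp_all, force, subst prod.union_disjoint, simp_all)
  also have "prod ?g ?A = prod_from_0 (Suc N)"
    unfolding prod_from_0_def miss_def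
    by (rule prod.reindex_bij_witness[where i="\<lambda>d. 2 * z - int d" and j="\<lambda>n. nat (2 * z - n)"])
      (auto simp: nat_eq_iff)
  also have "prod ?g ?B = prod_from_1 j"
    unfolding prod_from_1_def miss_def
    by (rule prod.reindex_bij_witness[where i="\<lambda>d. 2 * z + int d" and j="\<lambda>n. nat (n - 2 * z)"])
      (auto simp: min_def)
  also have "prod ?g ?C = prod_from_0 j"
    unfolding prod_from_0_def miss_def
    by (rule prod.reindex_bij_witness[where i="\<lambda>d. 2 * z + 2 * int j - int d" and j="\<lambda>n. nat (2 * z + 2 * int j - n)"])
      (auto simp: min_def)
  also have "prod ?g ?D = prod_from_1 N"
    unfolding prod_from_1_def miss_def
    by (rule prod.reindex_bij_witness[where i="\<lambda>d. 2 * z + 2 * int j + int d" and j="\<lambda>n. nat (n - (2 * z + 2 * int j))"])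
      (auto simp: min_def)
  finally show ?thesis by (simp add: u_def)
qed

lemma prob_two_uncovered:
  "prob {w \<in> space M. z \<notin> covered w \<and> z + int j \<notin> covered w} = v * u j"
proof -
  let ?c = "\<lambda>n. nat (min \<bar>2 * z - n\<bar> \<bar>2 * (z + int j) - n\<bar>) + 2"
  have "m < nat (min \<bar>a\<bar> \<bar>b\<bar>) + 2 \<longleftrightarrow> int m < \<bar>a\<bar> + 2 \<and> int m < \<bar>b\<bar> + 2" for m :: nat and a b
    by linarith
  then have "z \<notin> covered w \<and> z + int j \<notin> covered w \<longleftrightarrow> (\<forall>n. \<Gamma> n w < ?c n)" for w
    unfolding covered_def cover_def by (simp add: not_le all_conj_distrib)
  then have eq: "prob {w \<in> space M. z \<notin> covered w \<and> z + int j \<notin> covered w} = prob {w \<in> space M. \<forall>n. \<Gamma> n w < ?c n}"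
    by simp
  have lim: "(\<lambda>N. (prod_from_0 (Suc N) * prod_from_1 N) * u j) \<longlonglongrightarrow> prob {w \<in> space M. \<forall>n. \<Gamma> n w < ?c n}"
    unfolding void_product[where z=z and j=j, symmetric]
  proof (rule prob_all_less_tendsto)
    show "(\<Union>N. {2 * z - int N..2 * (z + int j) + int N}) = UNIV"
    proof (intro equalityI subsetI UNIV_I)
      fix n
      show "n \<in> (\<Union>N. {2 * z - int N..2 * (z + int j) + int N})"
        by (rule UN_I[of "nat \<bar>2 * z - n\<bar>"]) auto
    qed
  qed (auto simp: incseq_def)
  have "(\<lambda>N. (prod_from_0 (Suc N) * prod_from_1 N) * u j) \<longlonglongrightarrow> v * u j"
    using void_tendsto by (intro tendsto_mult tendsto_const)
  with lim show ?thesis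
    unfolding eq by (rule LIMSEQ_unique)
qed

lemma prob_uncovered: "prob {w \<in> space M. z \<notin> covered w} = v"
  using prob_two_uncovered[of z 0] by (simp add: u_0)

lemma pred_subset_covered [measurable]: "Measurable.pred M (\<lambda>w. K \<subseteq> covered w)"
  unfolding subset_eq by (intro pred_intros_countable_bounded pred_covered)

text \<open>Splitting according to the last uncovered point of a window. With \<open>E\<close> saying that the left end is uncovered
this becomes the renewal equation; with trivial \<open>E\<close> it gives the probability of a fully covered window.\<close>
lemma prob_last_uncovered:
  assumes "Measurable.pred M E"
  shows "prob {w \<in> space M. E w} = prob {w \<in> space M. E w \<and> {a..b} \<subseteq> covered w}
    + (\<Sum>z\<in>{a..b}. prob {w \<in> space M. E w \<and> z \<notin> covered w \<and> {z<..b} \<subseteq> covered w})"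
proof -
  let ?F = "{w \<in> space M. E w \<and> {a..b} \<subseteq> covered w}"
  let ?B = "\<lambda>z. {w \<in> space M. E w \<and> z \<notin> covered w \<and> {z<..b} \<subseteq> covered w}"
  have last: "\<exists>z\<in>{a..b}. z \<notin> covered w \<and> {z<..b} \<subseteq> covered w" if "\<not> {a..b} \<subseteq> covered w" for w
  proof -
    let ?Z = "{a..b} - covered w"
    have "Max ?Z \<in> ?Z" using that by (intro Max_in) auto
    moreover have "{Max ?Z<..b} \<subseteq> covered w"
    proof
      fix k assume k: "k \<in> {Max ?Z<..b}"
      show "k \<in> covered w"
      proof (rule ccontr)
        assume "k \<notin> covered w"
        then have "k \<in> ?Z" using k \<open>Max ?Z \<in> ?Z\<close> by auto
        then have "k \<le> Max ?Z" by (intro Max_ge) auto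
        then show False using k by simp
      qed
    qed
    ultimately show ?thesis by blast
  qed
  have unique: "y = z" if "y \<in> {a..b}" "z \<in> {a..b}" "y \<notin> covered w" "{y<..b} \<subseteq> covered w" "z \<notin> covered w" "{z<..b} \<subseteq> covered w"
    for y z w
  proof (rule ccontr)
    assume "y \<noteq> z"
    then have "z \<in> {y<..b} \<or> y \<in> {z<..b}" using that(1,2) by auto
    then show False using that by blast
  qed
  have B_sets: "?B z \<in> events" for z
    unfolding pred_def[symmetric] by (intro pred_intros_logic assms pred_covered pred_subset_covered)
  have "{w \<in> space M. E w} = ?F \<union> (\<Union>z\<in>{a..b}. ?B z)"
    using last by blast
  also have "prob \<dots> = prob ?F + prob (\<Union>z\<in>{a..b}. ?B z)"
  proof (rule finite_measure_Union)
    show "?F \<inter> (\<Union>z\<in>{a..b}. ?B z) = {}" by blast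
    show "?F \<in> events"
      unfolding pred_def[symmetric] by (intro pred_intros_logic assms pred_subset_covered)
    show "(\<Union>z\<in>{a..b}. ?B z) \<in> events"
      using B_sets by (intro sets.finite_UN) auto
  qed
  also have "prob (\<Union>z\<in>{a..b}. ?B z) = (\<Sum>z\<in>{a..b}. prob (?B z))"
  proof (rule finite_measure_finite_Union)
    show "disjoint_family_on ?B {a..b}"
      unfolding disjoint_family_on_def
    proof (intro ballI impI equals0I)
      fix y z w assume "y \<in> {a..b}" "z \<in> {a..b}" "y \<noteq> z" "w \<in> ?B y \<inter> ?B z"
      then show False using unique[of y z w] by simp
    qed
    show "?B ` {a..b} \<subseteq> events" using B_sets by blast
  qed simp
  finally show ?thesis .
qed

text \<open>Division by \<open>v\<close>, the probability that \<open>z\<close> is uncovered, makes this a conditional probability. The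
position \<open>z\<close> is kept until translation invariance is established.\<close>
definition T_at :: "int \<Rightarrow> nat \<Rightarrow> real" where
  "T_at z m = prob {w \<in> space M. z \<notin> covered w \<and> {z<..z + int m} \<subseteq> covered w} / v"

definition T :: "nat \<Rightarrow> real" where
  "T = T_at 0"

lemma prob_two_uncovered_then_covered:
  "prob {w \<in> space M. z \<notin> covered w \<and> z + int j \<notin> covered w \<and> {z + int j<..z + int j + int m} \<subseteq> covered w}
    = v * (u j * T_at (z + int j) m)"
proof (cases "j = 0")
  case True
  then show ?thesis using v_pos by (simp add: T_at_def u_0)
next
  case False
  let ?K = "{z + int j<..z + int j + int m}"
  have "prob {w \<in> space M. z + int j \<notin> covered w \<and> covered w \<inter> {z} = {} \<and> covered w \<inter> ?K = ?K} * v
      = prob {w \<in> space M. z + int j \<notin> covered w \<and> covered w \<inter> {z} = {}}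
        * prob {w \<in> space M. z + int j \<notin> covered w \<and> covered w \<inter> ?K = ?K}"
    unfolding prob_uncovered[of "z + int j", symmetric]
    by (rule uncovered_indep) (use False in auto)
  moreover have "covered w \<inter> {z} = {} \<longleftrightarrow> z \<notin> covered w" "covered w \<inter> ?K = ?K \<longleftrightarrow> ?K \<subseteq> covered w" for w by auto
  ultimately have "prob {w \<in> space M. z \<notin> covered w \<and> z + int j \<notin> covered w \<and> ?K \<subseteq> covered w} * v
      = prob {w \<in> space M. z \<notin> covered w \<and> z + int j \<notin> covered w}
        * prob {w \<in> space M. z + int j \<notin> covered w \<and> ?K \<subseteq> covered w}"
    by (simp only: conj_ac)
  then show ?thesis
    unfolding prob_two_uncovered T_at_def using v_pos by (simp add: field_simps)
qed

lemma renewal_at: "(\<Sum>j\<le>m. u j * T_at (z + int j) (m - j)) = 1"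
proof -
  have "v = prob {w \<in> space M. z \<notin> covered w \<and> {z..z + int m} \<subseteq> covered w}
      + (\<Sum>y\<in>{z..z + int m}. prob {w \<in> space M. z \<notin> covered w \<and> y \<notin> covered w \<and> {y<..z + int m} \<subseteq> covered w})"
    unfolding prob_uncovered[of z, symmetric] by (rule prob_last_uncovered) measurable
  also have "{w \<in> space M. z \<notin> covered w \<and> {z..z + int m} \<subseteq> covered w} = {}"
    by (auto simp: subset_iff)
  also have "(\<Sum>y\<in>{z..z + int m}. prob {w \<in> space M. z \<notin> covered w \<and> y \<notin> covered w \<and> {y<..z + int m} \<subseteq> covered w})
      = (\<Sum>j\<le>m. v * (u j * T_at (z + int j) (m - j)))"
  proof (rule sum.reindex_bij_witness[where i="\<lambda>j. z + int j" and j="\<lambda>y. nat (y - z)"])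
    fix y assume y: "y \<in> {z..z + int m}"
    define j where "j = nat (y - z)"
    have "y = z + int j" "z + int m = z + int j + int (m - j)" using y by (auto simp: j_def)
    then show "v * (u (nat (y - z)) * T_at (z + int (nat (y - z))) (m - nat (y - z)))
        = prob {w \<in> space M. z \<notin> covered w \<and> y \<notin> covered w \<and> {y<..z + int m} \<subseteq> covered w}"
      unfolding j_def[symmetric] prob_two_uncovered_then_covered[symmetric] by (simp only:)
  qed auto
  finally have "v = v * (\<Sum>j\<le>m. u j * T_at (z + int j) (m - j))"
    by (simp add: sum_distrib_left)
  then show ?thesis using v_pos by simp
qed

text \<open>Translation invariance: the renewal equation determines these probabilities recursively from \<open>u\<close>, which
does not depend on the position.\<close>
lemma T_at_eq: "T_at z m = T m"
proof (induction m arbitrary: z rule: less_induct)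
  case (less m)
  have split: "T_at y m = 1 - (\<Sum>j\<in>{1..m}. u j * T_at (y + int j) (m - j))" for y
    using renewal_at[where z=y and m=m] by (simp add: atMost_atLeast0 sum.atLeast_Suc_atMost u_0)
  have "(\<Sum>j\<in>{1..m}. u j * T_at (z + int j) (m - j)) = (\<Sum>j\<in>{1..m}. u j * T_at (0 + int j) (m - j))"
    by (intro sum.cong refl) (simp add: less.IH)
  then show ?case unfolding T_def split[of z] split[of 0] by simp
qed

sublocale renewal_sequence u T t v
proof
  show "0 \<le> T m" for m
    using v_pos by (simp add: T_def T_at_def)
  show "(\<Sum>j\<le>m. u j * T (m - j)) = 1" for m
    using renewal_at[where z=0 and m=m] by (simp add: T_at_eq)
qed (use u_0 u_tendsto v_pos t_pos u_decreasing u_increments in auto)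

lemma prob_run_after_uncovered:
  "prob {w \<in> space M. z \<notin> covered w \<and> {z<..z + int m} \<subseteq> covered w} = v * T m"
  using T_at_eq[of z m] v_pos by (simp add: T_at_def field_simps)

lemma prob_covered_interval:
  "prob {w \<in> space M. {a..<a + int m} \<subseteq> covered w} = 1 - v * (\<Sum>i<m. T i)"
proof -
  have "1 = prob {w \<in> space M. True}" by (simp add: prob_space)
  also have "\<dots> = prob {w \<in> space M. True \<and> {a..a + int m - 1} \<subseteq> covered w}
      + (\<Sum>z\<in>{a..a + int m - 1}. prob {w \<in> space M. True \<and> z \<notin> covered w \<and> {z<..a + int m - 1} \<subseteq> covered w})"
    by (rule prob_last_uncovered) simp
  also have "(\<Sum>z\<in>{a..a + int m - 1}. prob {w \<in> space M. True \<and> z \<notin> covered w \<and> {z<..a + int m - 1} \<subseteq> covered w})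
      = (\<Sum>i<m. v * T i)"
  proof (rule sum.reindex_bij_witness[where i="\<lambda>i. a + int m - 1 - int i" and j="\<lambda>z. nat (a + int m - 1 - z)"])
    fix z assume "z \<in> {a..a + int m - 1}"
    then have "z + int (nat (a + int m - 1 - z)) = a + int m - 1" by simp
    then show "v * T (nat (a + int m - 1 - z))
        = prob {w \<in> space M. True \<and> z \<notin> covered w \<and> {z<..a + int m - 1} \<subseteq> covered w}"
      unfolding prob_run_after_uncovered[of z, symmetric] by simp
  qed auto
  also have "{a..a + int m - 1} = {a..<a + int m}" by auto
  finally show ?thesis by (simp add: sum_distrib_left)
qed

text \<open>If some point of the window is uncovered, everything to the left of the last such point \<open>z\<close> can be factored
out by conditional independence, and the ratio \<open>T (Suc m) / T m\<close> remains. If the whole window is covered,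
the ratio is that of the probabilities for \<open>m + 1\<close> and \<open>m\<close> consecutive covered points.\<close>
theorem prob_extend_right:
  assumes "a \<le> b" "A \<subseteq> {a..<b}"
  shows "prob {w \<in> space M. covered w \<inter> {a..<b} = A \<and> b \<in> covered w}
    \<le> 4 * t * prob {w \<in> space M. covered w \<inter> {a..<b} = A}"
proof (cases "A = {a..<b}")
  case True
  define m where "m = nat (b - a)"
  have b: "b = a + int m" using assms(1) by (simp add: m_def)
  have "covered w \<inter> {a..<b} = A \<and> b \<in> covered w \<longleftrightarrow> {a..<a + int (Suc m)} \<subseteq> covered w" for w
  proof -
    have "{a..<a + int (Suc m)} = insert b {a..<b}" by (auto simp: b)
    then show ?thesis using True by auto
  qed
  moreover have "covered w \<inter> {a..<b} = A \<longleftrightarrow> {a..<a + int m} \<subseteq> covered w" for w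
    using True by (auto simp: b)
  ultimately have eqs: "prob {w \<in> space M. covered w \<inter> {a..<b} = A \<and> b \<in> covered w} = 1 - v * (\<Sum>i<Suc m. T i)"
    "prob {w \<in> space M. covered w \<inter> {a..<b} = A} = 1 - v * (\<Sum>i<m. T i)"
    by (simp_all only: prob_covered_interval)
  have le: "(1 - u 1 + 2 * t) * (1 - v * (\<Sum>i<m. T i)) \<le> 4 * t * (1 - v * (\<Sum>i<m. T i))"
    using one_minus_u_1 by (intro mult_right_mono) (simp_all flip: prob_covered_interval[of a])
  show ?thesis
    unfolding eqs by (rule order_trans[OF delayed_Suc_le le])
next
  case False
  let ?Z = "{a..<b} - A"
  define z where "z = Max ?Z"
  have z: "z \<in> {a..<b}" "z \<notin> A"
    using Max_in[of ?Z] False assms(2) by (auto simp: z_def)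
  have run: "k \<in> A" if "k \<in> {z<..<b}" for k
  proof (rule ccontr)
    assume "k \<notin> A"
    then have "k \<in> ?Z" using that z by auto
    then have "k \<le> z" unfolding z_def by (intro Max_ge) auto
    then show False using that by simp
  qed
  define m where "m = nat (b - 1 - z)"
  have b: "b = z + int m + 1" using z by (simp add: m_def)
  let ?K = "{a..<z}" and ?A = "A \<inter> {a..<z}"
  have window: "{a..<b} = ?K \<union> {z} \<union> {z<..z + int m}" using z by (auto simp: b)
  have A: "A = ?A \<union> {z<..z + int m}"
    using assms(2) z(2) run unfolding window by (auto simp: b)
  have pattern: "covered w \<inter> {a..<b} = A \<longleftrightarrow>
      z \<notin> covered w \<and> covered w \<inter> ?K = ?A \<and> covered w \<inter> {z<..z + int m} = {z<..z + int m}" for w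
  proof -
    have disj: "?K \<inter> {z<..z + int m} = {}" "z \<notin> ?K" "z \<notin> {z<..z + int m}" by auto
    show ?thesis
      unfolding window using A disj z(2) by blast
  qed
  have next_pattern: "covered w \<inter> {a..<b} = A \<and> b \<in> covered w \<longleftrightarrow>
      z \<notin> covered w \<and> covered w \<inter> ?K = ?A \<and> covered w \<inter> {z<..z + int (Suc m)} = {z<..z + int (Suc m)}" for w
  proof -
    have "{z<..z + int (Suc m)} = insert b {z<..z + int m}" by (auto simp: b)
    then show ?thesis unfolding pattern by auto
  qed
  define p where "p = prob {w \<in> space M. z \<notin> covered w \<and> covered w \<inter> ?K = ?A}"
  have fact: "prob {w \<in> space M. z \<notin> covered w \<and> covered w \<inter> ?K = ?A \<and> covered w \<inter> {z<..z + int n} = {z<..z + int n}} = p * T n" for n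
  proof -
    have "covered w \<inter> {z<..z + int n} = {z<..z + int n} \<longleftrightarrow> {z<..z + int n} \<subseteq> covered w" for w by blast
    then have "prob {w \<in> space M. z \<notin> covered w \<and> covered w \<inter> {z<..z + int n} = {z<..z + int n}} = v * T n"
      by (simp only: prob_run_after_uncovered)
    moreover have "?K \<subseteq> {..<z}" "{z<..z + int n} \<subseteq> {z<..}" "?A \<subseteq> ?K" by auto
    ultimately show ?thesis
      using uncovered_indep[of ?A ?K z "{z<..z + int n}" "{z<..z + int n}"] v_pos
      unfolding p_def prob_uncovered by simp
  qed
  have "T (Suc m) \<le> (1 - u 1 + t) * T m" by (rule T_Suc_le)
  also have "\<dots> \<le> 4 * t * T m"
    using one_minus_u_1 t_pos T_nonneg by (intro mult_right_mono) auto
  finally have "p * T (Suc m) \<le> p * (4 * t * T m)"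
    by (intro mult_left_mono) (simp_all add: p_def)
  then show ?thesis unfolding next_pattern unfolding pattern fact by (simp add: mult_ac)
qed

end

section \<open>The two covering sets on one probability space\<close>

lemma measure_geometric_lessThan:
  assumes "0 < t" "t < 1"
  shows "measure (measure_pmf (geometric_pmf (1 - t))) {..<r} = 1 - t ^ r"
proof -
  have "measure (measure_pmf (geometric_pmf (1 - t))) {..<r} = (\<Sum>i<r. t ^ i * (1 - t))"
    using assms by (subst measure_measure_pmf_finite) auto
  also have "\<dots> = 1 - t ^ r"
    by (simp add: one_diff_power_eq mult.commute flip: sum_distrib_left)
  finally show ?thesis .
qed

lemma sets_PiM_pmf: "sets (PiM I (\<lambda>i. measure_pmf (q i))) = sets (PiM I (\<lambda>_. count_space UNIV))"
  by (rule sets_PiM_cong) auto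

lemma distr_coordinate_pmf:
  "distr (PiM UNIV (\<lambda>_. measure_pmf q)) (count_space UNIV) (\<lambda>\<omega>. \<omega> i) = measure_pmf q"
proof -
  have "distr (PiM UNIV (\<lambda>_. measure_pmf q)) (count_space UNIV) (\<lambda>\<omega>. \<omega> i)
      = distr (PiM UNIV (\<lambda>_. measure_pmf q)) (measure_pmf q) (\<lambda>\<omega>. \<omega> i)"
    by (rule distr_cong) auto
  also have "\<dots> = measure_pmf q"
    using distr_PiM_component[of UNIV "\<lambda>_. measure_pmf q" i] measure_pmf.prob_space_axioms by auto
  finally show ?thesis .
qed

lemma prob_space_PiM_pmf: "prob_space (PiM UNIV (\<lambda>_. measure_pmf q))"
  by (intro prob_space_PiM measure_pmf.prob_space_axioms)

text \<open>The map \<open>f\<close> selects coordinates: the identity gives the enlarged covering, negation its mirror image, and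
doubling the integer centres.\<close>
lemma indep_vars_coordinates:
  fixes f :: "'i \<Rightarrow> 'i" and q :: "'b pmf"
  assumes "inj f"
  shows "prob_space.indep_vars (PiM UNIV (\<lambda>_. measure_pmf q)) (\<lambda>_. count_space UNIV) (\<lambda>i \<omega>. \<omega> (f i)) UNIV"
proof -
  let ?P = "PiM (UNIV :: 'i set) (\<lambda>_. measure_pmf q)"
  interpret P: prob_space ?P by (rule prob_space_PiM_pmf)
  have "distr ?P (PiM UNIV (\<lambda>_. count_space UNIV)) (\<lambda>\<omega>. \<lambda>i\<in>UNIV. \<omega> (f i))
      = distr ?P ?P (\<lambda>\<omega>. \<lambda>i\<in>UNIV. \<omega> (f i))"
    by (rule distr_cong) (auto simp: sets_PiM_pmf)
  also have "\<dots> = ?P"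
    using assms distr_PiM_reindex[of UNIV "\<lambda>_. measure_pmf q" f UNIV] measure_pmf.prob_space_axioms by auto
  also have "\<dots> = PiM UNIV (\<lambda>i. distr ?P (count_space UNIV) (\<lambda>\<omega>. \<omega> (f i)))"
    by (simp add: distr_coordinate_pmf)
  finally show ?thesis
    by (subst P.indep_vars_iff_distr_eq_PiM') auto
qed

lemma geometric_cover_coordinates:
  fixes f :: "int \<Rightarrow> int"
  assumes "0 < t" "t \<le> 1 / 2" "inj f"
  shows "geometric_cover (PiM UNIV (\<lambda>_. measure_pmf (geometric_pmf (1 - t)))) (\<lambda>n \<omega>. \<omega> (f n)) t"
proof -
  let ?P = "PiM (UNIV :: int set) (\<lambda>_. measure_pmf (geometric_pmf (1 - t)))"
  interpret P: prob_space ?P by (rule prob_space_PiM_pmf)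
  show ?thesis
  proof
    show "P.indep_vars (\<lambda>_. count_space UNIV) (\<lambda>n \<omega>. \<omega> (f n)) UNIV"
      using assms(3) by (rule indep_vars_coordinates)
    show "measure ?P {w \<in> space ?P. w (f n) < r} = 1 - t ^ r" for n r
    proof -
      have "measure ?P {w \<in> space ?P. w (f n) < r} = measure (distr ?P (count_space UNIV) (\<lambda>\<omega>. \<omega> (f n))) {..<r}"
        by (subst measure_distr) (auto simp: vimage_def Int_def conj_commute)
      then show ?thesis
        unfolding distr_coordinate_pmf using assms by (simp add: measure_geometric_lessThan)
    qed
  qed (use assms in auto)
qed

definition intervals_union :: "(int \<Rightarrow> nat) \<Rightarrow> int set" where
  "intervals_union g = {k. \<exists>n. \<bar>k - n\<bar> < int (g n)}"

lemma pred_PiM_component: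
  "Measurable.pred (PiM UNIV (\<lambda>_. count_space UNIV)) (\<lambda>g. Q (g n))"
proof -
  have "(\<lambda>g. g n) \<in> measurable (PiM UNIV (\<lambda>_. count_space UNIV)) (count_space UNIV)"
    by (rule measurable_component_singleton) simp
  then show ?thesis by (rule measurable_compose) simp
qed

lemma measurable_intervals_union: "intervals_union \<in> measurable (PiM UNIV (\<lambda>_. count_space UNIV)) subset_space"
  unfolding measurable_subset_space_iff pred_def[symmetric] intervals_union_def mem_Collect_eq
  by (intro allI pred_intros_countable pred_PiM_component)

lemma measurable_cover: "cover \<in> measurable (PiM UNIV (\<lambda>_. count_space UNIV)) subset_space"
  unfolding measurable_subset_space_iff pred_def[symmetric] cover_def mem_Collect_eq
  by (intro allI pred_intros_countable pred_PiM_component)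

lemma distr_iid_Geom:
  assumes M: "prob_space M" and indep: "prob_space.indep_vars M (\<lambda>_. count_space UNIV) G UNIV"
    and geom: "\<And>n. has_Geom M (G n) c" and c: "0 < c" "c < 1"
  shows "distr M (PiM UNIV (\<lambda>_. count_space UNIV)) (\<lambda>w n. G n w) = PiM UNIV (\<lambda>_. measure_pmf (geometric_pmf (1 - c)))"
proof -
  interpret prob_space M by fact
  have G: "G n \<in> measurable M (count_space UNIV)" for n
    using geom by (simp add: has_Geom_def)
  have "distr M (count_space UNIV) (G n) = measure_pmf (geometric_pmf (1 - c))" for n
  proof (rule measure_eqI_countable[of _ UNIV])
    fix r
    have "emeasure (distr M (count_space UNIV) (G n)) {r} = ennreal (measure M {w \<in> space M. G n w = r})"
      using G by (subst emeasure_distr) (auto simp: emeasure_eq_measure vimage_def Int_def conj_commute)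
    also have "\<dots> = ennreal (pmf (geometric_pmf (1 - c)) r)"
      using geom[of n] c by (simp add: has_Geom_def mult.commute)
    finally show "emeasure (distr M (count_space UNIV) (G n)) {r} = emeasure (measure_pmf (geometric_pmf (1 - c))) {r}"
      by (simp add: emeasure_pmf_single)
  qed auto
  moreover have "distr M (PiM UNIV (\<lambda>_. count_space UNIV)) (\<lambda>w. \<lambda>n\<in>UNIV. G n w)
      = PiM UNIV (\<lambda>n. distr M (count_space UNIV) (G n))"
    using indep G by (subst (asm) indep_vars_iff_distr_eq_PiM') auto
  ultimately show ?thesis by (simp add: restrict_UNIV)
qed

lemma distr_intervals_union_iid_Geom:
  assumes "prob_space M" "prob_space.indep_vars M (\<lambda>_. count_space UNIV) G UNIV"
    and geom: "\<And>n. has_Geom M (G n) c" and "0 < c" "c < 1"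
  shows "(\<lambda>w. intervals_union (\<lambda>n. G n w)) \<in> measurable M subset_space"
    and "distr M subset_space (\<lambda>w. intervals_union (\<lambda>n. G n w))
      = distr (PiM UNIV (\<lambda>_. measure_pmf (geometric_pmf (1 - c)))) subset_space intervals_union"
proof -
  have G: "(\<lambda>w n. G n w) \<in> measurable M (PiM UNIV (\<lambda>_. count_space UNIV))"
    using geom by (intro measurable_PiM_single') (auto simp: has_Geom_def)
  show "(\<lambda>w. intervals_union (\<lambda>n. G n w)) \<in> measurable M subset_space"
    using G measurable_intervals_union by (rule measurable_compose)
  show "distr M subset_space (\<lambda>w. intervals_union (\<lambda>n. G n w))
      = distr (PiM UNIV (\<lambda>_. measure_pmf (geometric_pmf (1 - c)))) subset_space intervals_union"
    unfolding distr_iid_Geom[OF assms, symmetric]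
    by (subst distr_distr[OF measurable_intervals_union G]) (simp add: comp_def)
qed

lemma has_Geom_halved:
  assumes "0 < t" "t < 1"
  shows "has_Geom (PiM UNIV (\<lambda>_. measure_pmf (geometric_pmf (1 - t)))) (\<lambda>\<omega>. \<omega> i div 2) (t\<^sup>2)"
proof -
  let ?P = "PiM UNIV (\<lambda>_. measure_pmf (geometric_pmf (1 - t)))"
  have coord: "(\<lambda>\<omega>. \<omega> i) \<in> measurable ?P (count_space UNIV)"
    using measurable_component_singleton[of i UNIV "\<lambda>_. count_space UNIV :: nat measure"]
    by (subst measurable_cong_sets[OF sets_PiM_pmf refl]) simp
  have "measure ?P {w \<in> space ?P. w i div 2 = r} = (1 - t\<^sup>2) * (t\<^sup>2) ^ r" for r
  proof -
    have "measure ?P {w \<in> space ?P. w i div 2 = r}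
        = measure (distr ?P (count_space UNIV) (\<lambda>\<omega>. \<omega> i)) {x. x div 2 = r}"
      using coord by (subst measure_distr) (auto simp: vimage_def Int_def conj_commute)
    also have "{x. x div 2 = r} = {2 * r, 2 * r + 1}" by auto
    also have "measure (distr ?P (count_space UNIV) (\<lambda>\<omega>. \<omega> i)) \<dots> = t ^ (2 * r) * (1 - t) + t ^ (2 * r + 1) * (1 - t)"
      unfolding distr_coordinate_pmf using assms by (subst measure_measure_pmf_finite) auto
    also have "\<dots> = (1 - t\<^sup>2) * (t\<^sup>2) ^ r"
      by (simp add: power_mult power2_eq_square algebra_simps)
    finally show ?thesis .
  qed
  moreover have "(\<lambda>\<omega>. \<omega> i div 2) \<in> measurable ?P (count_space UNIV)"
    using coord by (rule measurable_compose) simp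
  ultimately show ?thesis by (simp add: has_Geom_def)
qed

lemma intervals_union_halved_subset_cover: "intervals_union (\<lambda>n. g (2 * n) div 2) \<subseteq> cover g"
proof
  fix k assume "k \<in> intervals_union (\<lambda>n. g (2 * n) div 2)"
  then obtain n where "\<bar>k - n\<bar> < int (g (2 * n) div 2)" by (auto simp: intervals_union_def)
  then have "\<bar>2 * k - 2 * n\<bar> + 2 \<le> int (g (2 * n))" by linarith
  then show "k \<in> cover g" by (auto simp: cover_def)
qed

text \<open>The enumeration \<open>0, 1, -1, 2, -2, \<dots>\<close>: its initial segments are intervals, and the next point is
adjacent on the left for even and on the right for odd indices.\<close>
definition zigzag :: "nat \<Rightarrow> int" where
  "zigzag n = (if even n then - int (n div 2) else int (n div 2) + 1)"

lemma bij_zigzag: "bij zigzag"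
proof (rule bijI)
  show "inj zigzag"
    by (rule injI) (auto simp: zigzag_def split: if_splits elim!: evenE oddE)
  show "surj zigzag"
  proof (rule surjI)
    fix k
    show "zigzag (if k \<le> 0 then 2 * nat (- k) else 2 * nat (k - 1) + 1) = k"
      by (simp add: zigzag_def)
  qed
qed

lemma zigzag_window:
  "zigzag ` {..<2 * k} = {1 - int k..<int k + 1}"
  "zigzag ` {..<2 * k + 1} = {- int k..<int k + 1}"
proof (induction k)
  case (Suc k)
  have "zigzag ` {..<2 * Suc k} = insert (zigzag (2 * k + 1)) (zigzag ` {..<2 * k + 1})"
    by (simp add: lessThan_Suc)
  then show even: "zigzag ` {..<2 * Suc k} = {1 - int (Suc k)..<int (Suc k) + 1}"
    unfolding Suc.IH by (auto simp: zigzag_def)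
  have "zigzag ` {..<2 * Suc k + 1} = insert (zigzag (2 * Suc k)) (zigzag ` {..<2 * Suc k})"
    by (simp add: lessThan_Suc)
  then show "zigzag ` {..<2 * Suc k + 1} = {- int (Suc k)..<int (Suc k) + 1}"
    unfolding even by (auto simp: zigzag_def)
qed (auto simp: zigzag_def)

lemma mem_cover_reflect: "k \<in> cover (\<lambda>n. g (- n)) \<longleftrightarrow> - k \<in> cover g"
proof
  assume "k \<in> cover (\<lambda>n. g (- n))"
  then obtain n where "\<bar>2 * k - n\<bar> + 2 \<le> int (g (- n))" by (auto simp: cover_def)
  then have "\<bar>2 * (- k) - (- n)\<bar> + 2 \<le> int (g (- n))" by linarith
  then show "- k \<in> cover g" unfolding cover_def mem_Collect_eq by (rule exI)
next
  assume "- k \<in> cover g"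
  then obtain n where "\<bar>2 * (- k) - n\<bar> + 2 \<le> int (g n)" by (auto simp: cover_def)
  then have "\<bar>2 * k - (- n)\<bar> + 2 \<le> int (g (- (- n)))" by simp
  then show "k \<in> cover (\<lambda>n. g (- n))" unfolding cover_def mem_Collect_eq by (rule exI)
qed

text \<open>Extensions to the left become extensions to the right after reflecting all centres.\<close>
lemma prob_extend_zigzag:
  fixes t :: real and L :: "(int \<Rightarrow> nat) measure"
  defines "L \<equiv> PiM UNIV (\<lambda>_. measure_pmf (geometric_pmf (1 - t)))"
  assumes t: "0 < t" "t \<le> 1 / 2" and A: "A \<subseteq> zigzag ` {..<n}"
  shows "measure L {g \<in> space L. cover g \<inter> zigzag ` {..<n} = A \<and> zigzag n \<in> cover g}
    \<le> 4 * t * measure L {g \<in> space L. cover g \<inter> zigzag ` {..<n} = A}"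
proof (cases "even n")
  case True
  then obtain k where n: "n = 2 * k" by (elim evenE)
  interpret R: geometric_cover L "\<lambda>n \<omega>. \<omega> (- n)" t
    unfolding L_def using t by (rule geometric_cover_coordinates) (simp add: inj_on_def)
  have window: "zigzag ` {..<n} = uminus ` {- int k..<int k}"
    unfolding n zigzag_window by (auto simp: image_iff intro!: bexI[of _ "- _"])
  have z: "zigzag n = - int k" by (simp add: n zigzag_def)
  have covered: "R.covered g = uminus ` cover g" for g
    unfolding R.covered_def by (auto simp: mem_cover_reflect image_iff intro!: bexI[of _ "- _"])
  have pattern: "cover g \<inter> uminus ` {- int k..<int k} = A \<longleftrightarrow> R.covered g \<inter> {- int k..<int k} = uminus ` A" for g
  proof -
    have "uminus ` R.covered g = cover g"
      unfolding covered image_image by simp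
    then have "cover g \<inter> uminus ` {- int k..<int k} = uminus ` (R.covered g \<inter> {- int k..<int k})"
      by (subst image_Int) (simp_all add: inj_on_def)
    moreover have "uminus ` S = A \<longleftrightarrow> S = uminus ` A" for S
      by (auto simp: image_image)
    ultimately show ?thesis by (simp only:)
  qed
  have point: "- int k \<in> cover g \<longleftrightarrow> int k \<in> R.covered g" for g
    unfolding R.covered_def mem_cover_reflect ..
  have "uminus ` A \<subseteq> {- int k..<int k}"
    using A unfolding window by auto
  then show ?thesis
    unfolding window z pattern point by (intro R.prob_extend_right) auto
next
  case False
  then obtain k where n: "n = 2 * k + 1" by (elim oddE)
  interpret R: geometric_cover L "\<lambda>n \<omega>. \<omega> n" t
    unfolding L_def using t by (rule geometric_cover_coordinates) simp
  have z: "zigzag (2 * k + 1) = int k + 1" by (simp add: zigzag_def)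
  have covered: "R.covered g = cover g" for g by (simp add: R.covered_def)
  show ?thesis
    using R.prob_extend_right[of "- int k" "int k + 1" A] A unfolding n z zigzag_window covered by simp
qed

theorem theorem3:
  fixes c :: real
    and M :: "'w measure" and G :: "int \<Rightarrow> 'w \<Rightarrow> nat"
    and N :: "'v measure" and W :: "'v \<Rightarrow> int set"
  assumes "0 < c" and "c < 1"
    and "prob_space M"
    and "prob_space.indep_vars M (\<lambda>_. count_space UNIV) G UNIV"
    and "\<And>n. has_Geom M (G n) c"
    and "prob_space N"
    and "iid_site_percolation N W (min (4 * sqrt c) 1)"
  shows "stochastically_dominates subset_space N W M
           (\<lambda>w. {k :: int. real_of_int k \<in>
              (\<Union>n. {real_of_int n - real (G n w) <..< real_of_int n + real (G n w)})})"
proof -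
  define t where "t = sqrt c"
  have t: "0 < t" "t < 1" "t\<^sup>2 = c" using assms(1,2) by (simp_all add: t_def)
  define L where "L = PiM (UNIV :: int set) (\<lambda>_. measure_pmf (geometric_pmf (1 - t)))"
  interpret L: prob_space L unfolding L_def by (rule prob_space_PiM_pmf)
  have sets_L: "sets L = sets (PiM UNIV (\<lambda>_. count_space UNIV))"
    unfolding L_def by (rule sets_PiM_pmf)
  have cover: "cover \<in> measurable L subset_space"
    using measurable_cover by (subst measurable_cong_sets[OF sets_L refl])
  have indep: "L.indep_vars (\<lambda>_. count_space UNIV) (\<lambda>n \<omega>. \<omega> (2 * n) div 2) UNIV"
    using indep_vars_coordinates[of "\<lambda>n::int. 2 * n" "geometric_pmf (1 - t)"]
    unfolding L_def[symmetric] by (intro L.indep_vars_compose2[where Y="\<lambda>_ x. x div 2"]) (auto simp: inj_on_def)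
  have geom: "has_Geom L (\<lambda>\<omega>. \<omega> (2 * n) div 2) c" for n
    unfolding L_def t(3)[symmetric] using t(1,2) by (rule has_Geom_halved)
  note halved = distr_intervals_union_iid_Geom[OF L.prob_space_axioms indep geom assms(1,2)]
  note original = distr_intervals_union_iid_Geom[OF assms(3-5,1,2)]
  have "stochastically_dominates subset_space N W M (\<lambda>w. intervals_union (\<lambda>n. G n w))"
  proof (rule stochastically_dominates_percolationI[OF L.prob_space_axioms cover bij_zigzag _
        halved(1) intervals_union_halved_subset_cover original(1) _ assms(6,7)])
    show "distr L subset_space (\<lambda>\<omega>. intervals_union (\<lambda>n. \<omega> (2 * n) div 2))
        = distr M subset_space (\<lambda>w. intervals_union (\<lambda>n. G n w))"
      unfolding halved(2) original(2) ..
    fix n A assume A: "A \<subseteq> zigzag ` {..<n}"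
    show "measure L {g \<in> space L. cover g \<inter> zigzag ` {..<n} = A \<and> zigzag n \<in> cover g}
        \<le> min (4 * sqrt c) 1 * measure L {g \<in> space L. cover g \<inter> zigzag ` {..<n} = A}"
    \<comment> \<open>In the second case the parameter is 1 and the bound is monotonicity of the measure.\<close>
    proof (cases "4 * t \<le> 1")
      case True
      then show ?thesis
        using prob_extend_zigzag[OF t(1) _ A] by (simp add: L_def t_def[symmetric] min_def)
    next
      case False
      have "measure L {g \<in> space L. cover g \<inter> zigzag ` {..<n} = A \<and> zigzag n \<in> cover g}
          \<le> measure L {g \<in> space L. cover g \<inter> zigzag ` {..<n} = A}"
        by (rule L.finite_measure_mono) (auto intro: sets_pattern_event[OF cover])
      then show ?thesis using False by (simp add: t_def min_def)
    qed
  qed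
  moreover have "{k :: int. real_of_int k \<in> (\<Union>n. {real_of_int n - real (G n w) <..< real_of_int n + real (G n w)})}
      = intervals_union (\<lambda>n. G n w)" for w
  proof -
    have "real_of_int k \<in> {real_of_int n - real m <..< real_of_int n + real m} \<longleftrightarrow> \<bar>k - n\<bar> < int m" for k n m
      by (simp, linarith)
    then show ?thesis unfolding intervals_union_def by (simp only: UN_iff UNIV_I simp_thms bex_UNIV)
  qed
  ultimately show ?thesis by simp
qed

end
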